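(* Let $\alpha$ be a positive integer. For every integer $m>9\alpha$, the linear system $\mathcal{L}_{2,3m+2\alpha}((m+\alpha)^2,m^8)$ is empty; that is, for ten points in general position in $\mathbb{P}^2$ there is no plane curve of degree $3m+2\alpha$ having multiplicity at least $m+\alpha$ at two of the points and multiplicity at least $m$ at the remaining eight points.
   Context: We work over the complex numbers. $\mathcal{L}_{2,d}(m_1,\dots,m_s)$ denotes the linear system of plane curves of degree $d$ with multiplicity at least $m_i$ at $p_i$, where $p_1,\dots,p_s\in\mathbb{P}^2$ are points in general position; $m^k$ means that the multiplicity $m$ is repeated $k$ times. *)

theory Defs
  imports "HOL-Analysis.Analysis" "HOL-Library.Poly_Mapping" "HOL-Library.Extended_Nat"
begin

type_synonym ('x, 'a) mpoly = "('x \<Rightarrow>\<^sub>0 nat) \<Rightarrow>\<^sub>0 'a"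

definition Const :: "'a::zero \<Rightarrow> ('x, 'a) mpoly"
  where "Const c = Poly_Mapping.single 0 c"

definition Var :: "'x \<Rightarrow> ('x, 'a::zero_neq_one) mpoly"
  where "Var j = Poly_Mapping.single (Poly_Mapping.single j 1) 1"

definition monom_deg :: "('x \<Rightarrow>\<^sub>0 nat) \<Rightarrow> nat"
  where "monom_deg t = (\<Sum>j\<in>Poly_Mapping.keys t. Poly_Mapping.lookup t j)"

text \<open>Evaluation through a map of coefficients \<open>h\<close>: the identity gives values,
  \<open>Const\<close> gives the substitution of polynomials for the variables.\<close>

definition mpoly_eval ::
    "('a::zero \<Rightarrow> 'b::comm_semiring_1) \<Rightarrow> ('x \<Rightarrow> 'b) \<Rightarrow> ('x, 'a) mpoly \<Rightarrow> 'b"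
  where "mpoly_eval h x F =
    (\<Sum>t\<in>Poly_Mapping.keys F. h (Poly_Mapping.lookup F t) *
      (\<Prod>j\<in>Poly_Mapping.keys t. x j ^ Poly_Mapping.lookup t j))"

definition homogeneous :: "nat \<Rightarrow> ('x, 'a::zero) mpoly \<Rightarrow> bool"
  where "homogeneous d F \<longleftrightarrow> (\<forall>t\<in>Poly_Mapping.keys F. monom_deg t = d)"

definition proportional :: "complex ^ 3 \<Rightarrow> complex ^ 3 \<Rightarrow> bool"
  where "proportional v w \<longleftrightarrow> v \<noteq> 0 \<and> w \<noteq> 0 \<and> (\<exists>c. c \<noteq> 0 \<and> w = c *s v)"

quotient_type proj_plane = "complex ^ 3" / partial: proportional
proof (rule part_equivpI)
  show "\<exists>v. proportional v v"
    by (rule exI[of _ 1]) (auto simp: proportional_def vec_eq_iff intro!: exI[of _ 1])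
  show "symp proportional"
  proof (rule sympI)
    fix v w assume "proportional v w"
    then obtain c where "v \<noteq> 0" "w \<noteq> 0" "c \<noteq> 0" "w = c *s v"
      by (auto simp: proportional_def)
    then have "v = inverse c *s w" by (simp add: vec_eq_iff)
    with \<open>v \<noteq> 0\<close> \<open>w \<noteq> 0\<close> \<open>c \<noteq> 0\<close> show "proportional w v"
      unfolding proportional_def by (metis inverse_zero_imp_zero)
  qed
  show "transp proportional"
  proof (rule transpI)
    fix u v w assume "proportional u v" "proportional v w"
    then obtain b c where "u \<noteq> 0" "w \<noteq> 0" "b \<noteq> 0" "v = b *s u" "c \<noteq> 0" "w = c *s v"
      by (auto simp: proportional_def)
    moreover from this have "w = (c * b) *s u" by (simp add: vec_eq_iff)
    ultimately show "proportional u w"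
      unfolding proportional_def by (metis mult_eq_0_iff)
  qed
qed

text \<open>The equation of the curve \<open>F = 0\<close> in the affine chart where the coordinate \<open>i\<close>
  is \<open>1\<close>, translated so that the point with homogeneous coordinates \<open>v\<close> becomes the
  origin.  It does not involve the variable \<open>i\<close>.\<close>

definition local_equation :: "3 \<Rightarrow> complex ^ 3 \<Rightarrow> (3, complex) mpoly \<Rightarrow> (3, complex) mpoly"
  where "local_equation i v F =
    mpoly_eval Const (\<lambda>j. if j = i then 1 else Var j + Const (v $ j / v $ i)) F"

text \<open>The least degree of a monomial occurring in the polynomial (\<open>\<infinity>\<close> for \<open>0\<close>).\<close>

definition order_at_origin :: "('x, 'a::zero) mpoly \<Rightarrow> enat"
  where "order_at_origin f = (INF t\<in>Poly_Mapping.keys f. enat (monom_deg t))"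

text \<open>The infimum runs over the charts containing the point.  For homogeneous \<open>F\<close> all
  of them give the same order.\<close>

lift_definition multiplicity :: "(3, complex) mpoly \<Rightarrow> proj_plane \<Rightarrow> enat"
  is "\<lambda>F v. INF i\<in>{i. v $ i \<noteq> 0}. order_at_origin (local_equation i v F)"
proof -
  fix F :: "(3, complex) mpoly" and v w :: "complex ^ 3"
  assume "proportional v w"
  then obtain c where c: "c \<noteq> 0" "w = c *s v"
    by (auto simp: proportional_def)
  then have "local_equation i w F = local_equation i v F" for i
    by (simp add: local_equation_def vector_smult_component cong: if_cong)
  moreover from c have "{i. w $ i \<noteq> 0} = {i. v $ i \<noteq> 0}" by simp
  ultimately show "(INF i\<in>{i. v $ i \<noteq> 0}. order_at_origin (local_equation i v F)) =
      (INF i\<in>{i. w $ i \<noteq> 0}. order_at_origin (local_equation i w F))"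
    by simp
qed

text \<open>A plane curve of degree \<open>d\<close> is given by a nonzero form of degree \<open>d\<close>, unique up to a
  scalar.  The linear system is represented by the set of the equations of its curves.\<close>

definition linear_system :: "nat \<Rightarrow> nat list \<Rightarrow> proj_plane list \<Rightarrow> (3, complex) mpoly set"
  where "linear_system d ms ps =
    {F. F \<noteq> 0 \<and> homogeneous d F \<and> (\<forall>i<length ms. enat (ms ! i) \<le> multiplicity F (ps ! i))}"

text \<open>Polynomials in the homogeneous coordinates of \<open>n\<close> points of the plane: the variable
  \<open>(i, j)\<close> is the coordinate \<open>j\<close> of the \<open>i\<close>-th point, for \<open>i < n\<close>.\<close>

definition multihomogeneous :: "nat \<Rightarrow> (nat \<times> 3, complex) mpoly \<Rightarrow> bool"
  where "multihomogeneous n f \<longleftrightarrow>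
    (\<exists>e. \<forall>t\<in>Poly_Mapping.keys f. Poly_Mapping.keys t \<subseteq> {..<n} \<times> UNIV \<and>
      (\<forall>i<n. (\<Sum>j\<in>UNIV. Poly_Mapping.lookup t (i, j)) = e i))"

text \<open>For multihomogeneous \<open>f\<close> the choice of representatives does not matter.\<close>

definition vanishes_at :: "(nat \<times> 3, complex) mpoly \<Rightarrow> proj_plane list \<Rightarrow> bool"
  where "vanishes_at f ps \<longleftrightarrow> mpoly_eval id (\<lambda>(i, j). rep_proj_plane (ps ! i) $ j) f = 0"

text \<open>The Zariski topology on the \<open>n\<close>-fold product of the plane, whose points are the lists
  of length \<open>n\<close>.\<close>

definition zariski_open :: "nat \<Rightarrow> proj_plane list set \<Rightarrow> bool"
  where "zariski_open n U \<longleftrightarrow>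
    (\<exists>S. (\<forall>f\<in>S. multihomogeneous n f) \<and>
      U = {ps. length ps = n \<and> \<not> (\<forall>f\<in>S. vanishes_at f ps)})"

text \<open>\<open>Q\<close> holds for \<open>n\<close> points in general position.  The product is irreducible, so a
  nonempty open set is dense.\<close>

definition for_general_points :: "nat \<Rightarrow> (proj_plane list \<Rightarrow> bool) \<Rightarrow> bool"
  where "for_general_points n Q \<longleftrightarrow>
    (\<exists>U. zariski_open n U \<and> U \<noteq> {} \<and> (\<forall>ps\<in>U. Q ps))"

end

theory Submission
  imports Defs "Berlekamp_Zassenhaus.Finite_Field" "Jordan_Normal_Form.Determinant"
begin

hide_const (open) up_ring.coeff up_ring.monom Module.smult Coset.order
no_notation Matrix.vec_index (infixl "$" 100)

text \<open>
  Blowing up the first two points and contracting the line through them turns the plane into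
  \<open>P\<^sup>1 \<times> P\<^sup>1\<close>.  With \<open>n = 2m + \<alpha>\<close> the system becomes the curves of bidegree \<open>(n, n)\<close> with nine points
  of multiplicity \<open>m\<close>: the contracted line gives the ninth.  Emptiness is an open condition on the
  points, so a single good configuration is enough.  Moreover the linear conditions that express the
  multiplicities have integral coefficients at integral points; if their only solution modulo a prime
  is zero, then some maximal minor is nonzero modulo that prime, hence a nonzero complex number, and
  this minor defines the open set.  The configuration may therefore be chosen over the field with
  13 elements.

  The configuration is one for which two classes that are not effective for general points are
  represented by irreducible curves \<open>N\<^sub>1\<close> of bidegree \<open>(4, 5)\<close> and \<open>N\<^sub>2\<close> of bidegree \<open>(5, 4)\<close>.  Each of
  them has one triple point and eight double points at the nine points, the two triple points being
  different, so that \<open>N\<^sub>1\<^sup>2 = N\<^sub>2\<^sup>2 = -1\<close> and \<open>N\<^sub>1 \<cdot> N\<^sub>2 = 1\<close>.  Hence \<open>N = N\<^sub>1 + N\<^sub>2\<close> satisfies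
  \<open>N \<cdot> N\<^sub>1 = N \<cdot> N\<^sub>2 = 0\<close>, and it is nef.  Its class is \<open>(9, 9; 5, 5, 4\<^sup>7)\<close>, and a curve \<open>D\<close> of the system
  would have \<open>N \<cdot> D = 18 n - 38 m = 18 \<alpha> - 2 m\<close>, which is negative precisely if \<open>m > 9\<alpha>\<close>.

  Each \<open>N\<^sub>i\<close> has arithmetic genus 1 and one further double point, so it is rational.  This makes
  the nefness elementary.  A polynomial is restricted to \<open>N\<^sub>i\<close> by substituting the parametrisation;
  the prescribed multiplicities are zeros of the resulting polynomial in one variable, so the restriction vanishes as soon as the intersection
  number is negative (\<open>bezout\<close>).  A polynomial with restriction zero is divisible by the equation of
  \<open>N\<^sub>i\<close> (\<open>dvd_if_restrict_eq_0\<close>), and division does not change the intersection number with \<open>N\<close>, so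
  that a polynomial with negative intersection number could be divided forever
  (\<open>nef_sum_of_two_curves\<close>).  The two curves are given by explicit certificates
  (\<open>nef_class_nonneg\<close>), \<open>no_curve_at_special_points\<close> is the resulting statement modulo 13, and
  \<open>nonzero_integral_minor_exists\<close> together with \<open>zariski_open_minor\<close> carries it over to general
  complex points.
\<close>

section \<open>Polynomials in two variables\<close>

definition const2 :: "'a::comm_ring_1 \<Rightarrow> 'a poly poly"
  where "const2 c = [:[:c:]:]"

abbreviation X2 :: "'a::comm_ring_1 poly poly" where "X2 \<equiv> [:0, 1:]"
abbreviation Y2 :: "'a::comm_ring_1 poly poly" where "Y2 \<equiv> [:[:0, 1:]:]"

text \<open>
  Translations, the exchange of the two variables, the chart of a blow-up and the restriction to a
  parametrised curve are all instances of this substitution, so that they are ring homomorphisms and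
  compose as expected.  In \<open>'a poly poly\<close> the outer variable is \<open>x\<close> and the inner one is \<open>y\<close>.
\<close>

definition subst2 :: "('a::comm_ring_1 \<Rightarrow> 'b::comm_ring_1) \<Rightarrow> 'b \<Rightarrow> 'b \<Rightarrow> 'a poly poly \<Rightarrow> 'b"
  where "subst2 h x y f = poly (map_poly (\<lambda>c. poly (map_poly h c) y) f) x"

lemma const2_hom: "comm_ring_hom (const2 :: 'a::comm_ring_1 \<Rightarrow> _)"
  by unfold_locales (auto simp: const2_def one_pCons)

lemma poly2_induct [case_names const add X Y]:
  fixes f :: "'a::comm_ring_1 poly poly"
  assumes c: "\<And>c. P (const2 c)"
    and a: "\<And>f g. P f \<Longrightarrow> P g \<Longrightarrow> P (f + g)"
    and X: "\<And>f. P f \<Longrightarrow> P (X2 * f)"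
    and Y: "\<And>f. P f \<Longrightarrow> P (Y2 * f)"
  shows "P f"
proof -
  have const: "P [:q:]" for q
  proof (induction q)
    case 0
    then show ?case using c[of 0] by (simp add: const2_def)
  next
    case (pCons c q)
    have "[:pCons c q:] = const2 c + Y2 * [:q:]" by (simp add: const2_def)
    then show ?case using a[OF c Y[OF pCons(2)]] by metis
  qed
  show ?thesis
  proof (induction f)
    case 0
    then show ?case using c[of 0] by (simp add: const2_def)
  next
    case (pCons q f)
    have "pCons q f = [:q:] + X2 * f" by simp
    then show ?case using a[OF const X[OF pCons(2)]] by metis
  qed
qed

lemma subst2_inner_hom:
  assumes "comm_ring_hom h"
  shows "comm_ring_hom (\<lambda>c. poly (map_poly h c) y)"
proof -
  interpret h: comm_ring_hom h by fact
  interpret map_poly_comm_ring_hom h ..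
  show ?thesis by unfold_locales (auto simp: hom_distribs)
qed

lemma subst2_hom:
  assumes "comm_ring_hom h"
  shows "comm_ring_hom (subst2 h x y)"
proof -
  interpret h: comm_ring_hom "\<lambda>c. poly (map_poly h c) y" by (rule subst2_inner_hom) fact
  interpret map_poly_comm_ring_hom "\<lambda>c. poly (map_poly h c) y" ..
  show ?thesis unfolding subst2_def by unfold_locales (auto simp: hom_distribs)
qed

context
  fixes h :: "'a::comm_ring_1 \<Rightarrow> 'b::comm_ring_1" and x y :: 'b
  assumes h: "comm_ring_hom h"
begin

interpretation h: comm_ring_hom h by (fact h)
interpretation s: comm_ring_hom "subst2 h x y" by (rule subst2_hom[OF h])

lemma subst2_add: "subst2 h x y (f + g) = subst2 h x y f + subst2 h x y g" by (rule s.hom_add)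
lemma subst2_mult: "subst2 h x y (f * g) = subst2 h x y f * subst2 h x y g" by (rule s.hom_mult)
lemma subst2_zero: "subst2 h x y 0 = 0" by (rule s.hom_zero)
lemma subst2_one: "subst2 h x y 1 = 1" by (rule s.hom_one)
lemma subst2_sum: "subst2 h x y (sum F I) = (\<Sum>i\<in>I. subst2 h x y (F i))" by (rule s.hom_sum)
lemma subst2_power: "subst2 h x y (f ^ n) = subst2 h x y f ^ n" by (rule s.hom_power)
lemma subst2_const: "subst2 h x y (const2 c) = h c"
  and subst2_X: "subst2 h x y X2 = x"
  and subst2_Y: "subst2 h x y Y2 = y"
proof -
  interpret i: comm_ring_hom "\<lambda>c. poly (map_poly h c) y" by (rule subst2_inner_hom[OF h])
  show "subst2 h x y (const2 c) = h c" "subst2 h x y X2 = x" "subst2 h x y Y2 = y"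
    unfolding subst2_def const2_def
    by (simp_all only: i.map_poly_pCons_hom map_poly_0 poly_pCons i.hom_zero i.hom_one poly_0)
      (simp_all add: h.map_poly_pCons_hom)
qed

lemmas subst2_simps = subst2_add subst2_mult subst2_zero subst2_one subst2_sum subst2_power
  subst2_const subst2_X subst2_Y

end

lemma subst2_subst2:
  assumes h: "comm_ring_hom h"
  shows "subst2 h x y (subst2 const2 u v f) = subst2 h (subst2 h x y u) (subst2 h x y v) f"
  by (induction f rule: poly2_induct) (simp_all only: subst2_simps[OF h] subst2_simps[OF const2_hom])

lemma subst2_const2_id: "subst2 const2 X2 Y2 f = f"
proof (induction f rule: poly2_induct)
qed (simp_all only: subst2_simps[OF const2_hom])

lemma coeff_X2_mult: "coeff (X2 * f) i = (if i = 0 then 0 else coeff f (i - 1))"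
  by (cases i) auto

lemma coeff_Y2_mult: "coeff (coeff (Y2 * f) i) j = (if j = 0 then 0 else coeff (coeff f i) (j - 1))"
  by (cases j) auto

lemma coeff_const2: "coeff (coeff (const2 c) i) j = (if i = 0 \<and> j = 0 then c else 0)"
  by (auto simp: const2_def coeff_pCons split: nat.splits)

definition swap2 :: "'a::comm_ring_1 poly poly \<Rightarrow> 'a poly poly"
  where "swap2 = subst2 const2 Y2 X2"

lemma coeff_swap2: "coeff (coeff (swap2 f) i) j = coeff (coeff f j) i"
proof (induction f arbitrary: i j rule: poly2_induct)
  case (const c)
  then show ?case by (simp add: swap2_def subst2_simps[OF const2_hom] coeff_const2)
next
  case (add f g)
  then show ?case by (simp add: swap2_def subst2_simps[OF const2_hom])
next
  case (X f)
  have "swap2 (X2 * f) = Y2 * swap2 f" by (simp only: swap2_def subst2_simps[OF const2_hom])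
  then show ?case by (simp only: coeff_Y2_mult coeff_X2_mult X if_distrib[of "\<lambda>p. coeff p i"] coeff_0)
next
  case (Y f)
  have "swap2 (Y2 * f) = X2 * swap2 f" by (simp only: swap2_def subst2_simps[OF const2_hom])
  then show ?case by (simp only: coeff_Y2_mult coeff_X2_mult Y if_distrib[of "\<lambda>p. coeff p j"] coeff_0)
qed

text \<open>
  The substitution \<open>(x, y) \<mapsto> (x, x y)\<close>, the chart of the blow-up of the origin.  It collects the
  monomials by their total degree: the power of \<open>x\<close> that divides the result is the multiplicity at
  the origin, and the degree in \<open>x\<close> is the total degree.  Both are thus additive for products because
  order and degree of polynomials in one variable over a domain are.
\<close>

definition fan2 :: "'a::comm_ring_1 poly poly \<Rightarrow> 'a poly poly"
  where "fan2 = subst2 const2 X2 (X2 * Y2)"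

lemma coeff_fan2: "coeff (coeff (fan2 f) l) j = (if j \<le> l then coeff (coeff f (l - j)) j else 0)"
proof (induction f arbitrary: l j rule: poly2_induct)
  case (const c)
  then show ?case by (auto simp: fan2_def subst2_simps[OF const2_hom] coeff_const2)
next
  case (add f g)
  then show ?case by (simp add: fan2_def subst2_simps[OF const2_hom])
next
  case (X f)
  have *: "fan2 (X2 * f) = X2 * fan2 f" by (simp only: fan2_def subst2_simps[OF const2_hom])
  have "coeff (coeff (X2 * fan2 f) l) j = (if l = 0 then 0 else coeff (coeff (fan2 f) (l - 1)) j)"
    by (simp only: coeff_X2_mult if_distrib[of "\<lambda>p. coeff p j"] coeff_0)
  also have "\<dots> = (if j \<le> l then coeff (coeff (X2 * f) (l - j)) j else 0)"
    by (auto simp: X coeff_X2_mult simp del: mult_pCons_left)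
  finally show ?case unfolding * .
next
  case (Y f)
  have *: "fan2 (Y2 * f) = X2 * (Y2 * fan2 f)"
    by (simp only: fan2_def subst2_simps[OF const2_hom] mult.assoc)
  have "coeff (coeff (X2 * (Y2 * fan2 f)) l) j
      = (if l = 0 \<or> j = 0 then 0 else coeff (coeff (fan2 f) (l - 1)) (j - 1))"
    by (auto simp only: coeff_X2_mult coeff_Y2_mult if_distrib[of "\<lambda>p. coeff p j"] coeff_0 split: if_splits)
  also have "\<dots> = (if j \<le> l then coeff (coeff (Y2 * f) (l - j)) j else 0)"
    by (auto simp: Y coeff_Y2_mult simp del: mult_pCons_left)
  finally show ?case unfolding * .
qed

definition shift2 :: "'a::comm_ring_1 \<Rightarrow> 'a \<Rightarrow> 'a poly poly \<Rightarrow> 'a poly poly"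
  where "shift2 a b = subst2 const2 (X2 + const2 a) (Y2 + const2 b)"

lemma poly_eq_sum_atMost:
  fixes p :: "'a::comm_ring_1 poly"
  assumes "degree p \<le> n"
  shows "poly p x = (\<Sum>i\<le>n. coeff p i * x ^ i)"
  unfolding poly_altdef using assms
  by (intro sum.mono_neutral_left) (auto simp: coeff_eq_0)

lemma degree_coeff_le_swap2: "degree (coeff f i) \<le> degree (swap2 f)"
proof (rule degree_le, intro allI impI)
  fix j assume "degree (swap2 f) < j"
  then have "coeff (swap2 f) j = 0" by (rule coeff_eq_0)
  then show "coeff (coeff f i) j = 0" by (metis coeff_swap2 coeff_0)
qed

lemma subst2_eq_sum:
  assumes h: "comm_ring_hom h" and a: "degree f \<le> a" and b: "degree (swap2 f) \<le> b"
  shows "subst2 h x y f = (\<Sum>i\<le>a. \<Sum>j\<le>b. h (coeff (coeff f i) j) * x ^ i * y ^ j)"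
proof -
  interpret h: comm_ring_hom h by (rule h)
  interpret i: comm_ring_hom "\<lambda>c. poly (map_poly h c) y" by (rule subst2_inner_hom[OF h])
  have "poly (map_poly h (coeff f i)) y = (\<Sum>j\<le>b. h (coeff (coeff f i) j) * y ^ j)" for i
  proof -
    have "degree (map_poly h (coeff f i)) \<le> b"
      using degree_map_poly_le degree_coeff_le_swap2 b by (meson order_trans)
    from poly_eq_sum_atMost[OF this] show ?thesis by (simp add: coeff_map_poly)
  qed
  moreover have "subst2 h x y f = (\<Sum>i\<le>a. poly (map_poly h (coeff f i)) y * x ^ i)"
  proof -
    have "degree (map_poly (\<lambda>c. poly (map_poly h c) y) f) \<le> a"
      using degree_map_poly_le a by (meson order_trans)
    from poly_eq_sum_atMost[OF this] show ?thesis
      unfolding subst2_def by (simp add: coeff_map_poly)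
  qed
  ultimately show ?thesis
    by (simp add: sum_distrib_right sum_distrib_left mult_ac)
qed

lemma swap2_swap2: "swap2 (swap2 f) = f"
  by (intro poly_eqI) (simp add: coeff_swap2)

lemma swap2_mult: "swap2 (f * g) = swap2 f * swap2 g"
  by (simp add: swap2_def subst2_mult[OF const2_hom])

lemma swap2_eq_0_iff: "swap2 f = 0 \<longleftrightarrow> f = 0"
  by (metis swap2_swap2 swap2_def subst2_zero[OF const2_hom])

lemma fan2_mult: "fan2 (f * g) = fan2 f * fan2 g"
  by (simp add: fan2_def subst2_mult[OF const2_hom])

lemma coeff_fan2_eq_0_iff: "coeff (fan2 f) l = 0 \<longleftrightarrow> (\<forall>i j. i + j = l \<longrightarrow> coeff (coeff f i) j = 0)"
proof
  assume "coeff (fan2 f) l = 0"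
  then show "\<forall>i j. i + j = l \<longrightarrow> coeff (coeff f i) j = 0"
    by (metis coeff_fan2 coeff_0 le_add2 add_diff_cancel_right')
next
  assume "\<forall>i j. i + j = l \<longrightarrow> coeff (coeff f i) j = 0"
  then show "coeff (fan2 f) l = 0" by (intro poly_eqI) (simp add: coeff_fan2)
qed

lemma fan2_eq_0_iff: "fan2 f = 0 \<longleftrightarrow> f = 0"
proof
  assume "fan2 f = 0"
  then have "coeff (coeff f i) j = 0" for i j using coeff_fan2_eq_0_iff[of f "i + j"] by simp
  then show "f = 0" by (intro poly_eqI) simp
qed (simp add: fan2_def subst2_zero[OF const2_hom])

lemma shift2_mult: "shift2 a b (f * g) = shift2 a b f * shift2 a b g"
  by (simp add: shift2_def subst2_mult[OF const2_hom])

lemma subst2_shift2: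
  assumes "comm_ring_hom h"
  shows "subst2 h x y (shift2 a b f) = subst2 h (x + h a) (y + h b) f"
  unfolding shift2_def subst2_subst2[OF assms] by (simp only: subst2_simps[OF assms])

lemma const2_minus: "const2 (- a) = - const2 a"
  by (simp add: const2_def)

lemma shift2_shift2_uminus: "shift2 (- a) (- b) (shift2 a b f) = f"
proof -
  have "shift2 (- a) (- b) (shift2 a b f) = subst2 const2 X2 Y2 f"
    unfolding shift2_def[of "- a"] subst2_shift2[OF const2_hom] by (simp only: const2_minus minus_add_cancel add.assoc right_minus left_minus add_0_right)
  then show ?thesis by (simp only: subst2_const2_id)
qed

lemma shift2_eq_0_iff: "shift2 a b f = 0 \<longleftrightarrow> f = 0"
  by (metis shift2_shift2_uminus shift2_def subst2_zero[OF const2_hom])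

lemma shift2_swap2: "shift2 a b (swap2 f) = swap2 (shift2 b a f)"
proof -
  have "shift2 a b (swap2 f) = subst2 const2 (Y2 + const2 b) (X2 + const2 a) f"
    unfolding shift2_def swap2_def subst2_subst2[OF const2_hom] by (simp only: subst2_simps[OF const2_hom])
  moreover have "swap2 (shift2 b a f) = subst2 const2 (Y2 + const2 b) (X2 + const2 a) f"
    unfolding shift2_def swap2_def subst2_subst2[OF const2_hom] by (simp only: subst2_simps[OF const2_hom])
  ultimately show ?thesis by simp
qed

lemma X2_plus_const2: "X2 + const2 a = [:[:a:], 1:]"
  by (simp add: const2_def)

lemma Y2_plus_const2: "Y2 + const2 b = [:[:b, 1:]:]"
  by (simp add: const2_def)

lemma coeff_monic_linear_power:
  fixes c :: "'a::comm_ring_1"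
  shows "coeff ([:c, 1:] ^ n) i = of_nat (n choose i) * c ^ (n - i)"
proof (cases "i \<le> n")
  case False
  have "degree ([:c, 1:] ^ n) \<le> n"
    using degree_power_le[of "[:c, 1:]" n] by simp
  with False show ?thesis by (simp add: coeff_eq_0 binomial_eq_0)
qed (simp add: coeff_linear_poly_power)

text \<open>
  The coefficients after a translation are the values of the Hasse derivatives, which make sense in
  every characteristic.
\<close>

lemma coeff_shift2:
  assumes a: "degree f \<le> m" and b: "degree (swap2 f) \<le> n"
  shows "coeff (coeff (shift2 u v f) p) q =
    (\<Sum>i\<le>m. \<Sum>j\<le>n. coeff (coeff f i) j * of_nat (i choose p) * of_nat (j choose q) * u ^ (i - p) * v ^ (j - q))"
proof -
  have "coeff (coeff (const2 c * (X2 + const2 u) ^ i * (Y2 + const2 v) ^ j) p) q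
    = c * of_nat (i choose p) * of_nat (j choose q) * u ^ (i - p) * v ^ (j - q)" for c i j
  proof -
    have y: "(Y2 + const2 v) ^ j = [:[:v, 1:] ^ j:]"
      unfolding Y2_plus_const2 by (induction j) (auto simp: one_pCons)
    have "coeff ((X2 + const2 u) ^ i) p = of_nat (i choose p) * [:u:] ^ (i - p)"
      unfolding X2_plus_const2 by (simp add: coeff_monic_linear_power)
    also have "\<dots> = [:of_nat (i choose p) * u ^ (i - p):]"
      by (simp add: of_nat_poly poly_const_pow)
    finally have x: "coeff ((X2 + const2 u) ^ i) p = [:of_nat (i choose p) * u ^ (i - p):]" .
    have "coeff (const2 c * (X2 + const2 u) ^ i * (Y2 + const2 v) ^ j) p
      = [:c:] * [:of_nat (i choose p) * u ^ (i - p):] * [:v, 1:] ^ j"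
      unfolding y const2_def[of c] by (simp add: x[symmetric] mult_ac)
    then show ?thesis by (simp add: coeff_monic_linear_power mult_ac)
  qed
  then show ?thesis
    unfolding shift2_def subst2_eq_sum[OF const2_hom a b] by (simp add: coeff_sum)
qed

definition mult2 :: "'a::idom \<Rightarrow> 'a \<Rightarrow> 'a poly poly \<Rightarrow> nat"
  where "mult2 a b f = order 0 (fan2 (shift2 a b f))"

abbreviation degX :: "'a::comm_ring_1 poly poly \<Rightarrow> nat" where "degX f \<equiv> degree f"
abbreviation degY :: "'a::comm_ring_1 poly poly \<Rightarrow> nat" where "degY f \<equiv> degree (swap2 f)"
abbreviation degT :: "'a::comm_ring_1 poly poly \<Rightarrow> nat" where "degT f \<equiv> degree (fan2 f)"

lemma order_0_ge_iff:
  fixes p :: "'a::idom poly"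
  assumes "p \<noteq> 0"
  shows "n \<le> order 0 p \<longleftrightarrow> (\<forall>l<n. coeff p l = 0)"
proof -
  have "n \<le> order 0 p \<longleftrightarrow> monom 1 n dvd p"
    using order_divides[of 0 n p] assms by (simp add: monom_altdef)
  then show ?thesis by (simp add: monom_1_dvd_iff')
qed

lemma mult2_ge_iff:
  assumes "f \<noteq> 0"
  shows "n \<le> mult2 a b f \<longleftrightarrow> (\<forall>p q. p + q < n \<longrightarrow> coeff (coeff (shift2 a b f) p) q = 0)"
  unfolding mult2_def using assms
  by (subst order_0_ge_iff) (auto simp: fan2_eq_0_iff shift2_eq_0_iff coeff_fan2_eq_0_iff)

lemma mult2_mult:
  assumes "f \<noteq> 0" "g \<noteq> 0"
  shows "mult2 a b (f * g) = mult2 a b f + mult2 a b g"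
  unfolding mult2_def using assms
  by (simp add: shift2_mult fan2_mult order_mult fan2_eq_0_iff shift2_eq_0_iff)

lemma degY_mult: "f \<noteq> 0 \<Longrightarrow> g \<noteq> 0 \<Longrightarrow> degY (f * g) = degY f + degY (g :: 'a::idom poly poly)"
  by (simp add: swap2_mult degree_mult_eq swap2_eq_0_iff)

lemma degT_mult: "f \<noteq> 0 \<Longrightarrow> g \<noteq> 0 \<Longrightarrow> degT (f * g) = degT f + degT (g :: 'a::idom poly poly)"
  by (simp add: fan2_mult degree_mult_eq fan2_eq_0_iff)

lemma coeff_fan2_swap2: "coeff (fan2 (swap2 f)) l = 0 \<longleftrightarrow> coeff (fan2 f) l = 0"
  by (auto simp: coeff_fan2_eq_0_iff coeff_swap2 add.commute)

lemma degT_swap2: "degT (swap2 f) = degT f"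
  unfolding Polynomial.degree_def by (simp add: coeff_fan2_swap2)

lemma mult2_swap2:
  fixes f :: "'a::idom poly poly"
  assumes "f \<noteq> 0"
  shows "mult2 a b (swap2 f) = mult2 b a f"
proof -
  have "n \<le> mult2 a b (swap2 f) \<longleftrightarrow> n \<le> mult2 b a f" for n
    using assms by (subst (1 2) mult2_ge_iff) (auto simp: swap2_eq_0_iff shift2_swap2 coeff_swap2 add.commute)
  then show ?thesis by (meson eq_iff)
qed

lemma degX_le_iff: "degX f \<le> n \<longleftrightarrow> (\<forall>i j. n < i \<longrightarrow> coeff (coeff f i) j = 0)"
proof
  assume "degX f \<le> n" then show "\<forall>i j. n < i \<longrightarrow> coeff (coeff f i) j = 0" by (auto simp: coeff_eq_0)
next
  assume "\<forall>i j. n < i \<longrightarrow> coeff (coeff f i) j = 0"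
  then show "degX f \<le> n" by (intro degree_le) (auto intro: poly_eqI)
qed

lemma degY_le_iff: "degY f \<le> n \<longleftrightarrow> (\<forall>i j. n < j \<longrightarrow> coeff (coeff f i) j = 0)"
  by (auto simp: degX_le_iff coeff_swap2)

lemma degT_le_iff: "degT f \<le> n \<longleftrightarrow> (\<forall>i j. n < i + j \<longrightarrow> coeff (coeff f i) j = 0)"
proof
  assume "degT f \<le> n"
  then have "coeff (fan2 f) l = 0" if "n < l" for l using that by (simp add: coeff_eq_0)
  then show "\<forall>i j. n < i + j \<longrightarrow> coeff (coeff f i) j = 0" by (auto simp: coeff_fan2_eq_0_iff)
next
  assume "\<forall>i j. n < i + j \<longrightarrow> coeff (coeff f i) j = 0"
  then show "degT f \<le> n" by (intro degree_le) (auto simp: coeff_fan2_eq_0_iff)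
qed

section \<open>Restriction to a parametrised curve\<close>

text \<open>
  The value at \<open>x = A / B\<close>, \<open>y = C / D\<close> multiplied by \<open>B\<^sup>a D\<^sup>b\<close>, which clears the denominators for
  polynomials of bidegree at most \<open>(a, b)\<close>.
\<close>

definition homog2 :: "nat \<Rightarrow> nat \<Rightarrow> 'a::comm_ring_1 poly \<Rightarrow> 'a poly \<Rightarrow> 'a poly \<Rightarrow> 'a poly \<Rightarrow> 'a poly poly \<Rightarrow> 'a poly"
  where "homog2 a b A B C D f =
    (\<Sum>i\<le>a. \<Sum>j\<le>b. smult (coeff (coeff f i) j) (A ^ i * B ^ (a - i) * (C ^ j * D ^ (b - j))))"

definition const_fract :: "'a::idom \<Rightarrow> 'a poly fract"
  where "const_fract c = to_fract [:c:]"

lemma const_fract_hom: "comm_ring_hom (const_fract :: 'a::idom \<Rightarrow> _)"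
  by unfold_locales (simp_all add: const_fract_def flip: to_fract_add to_fract_mult one_pCons)

lemma to_fract_power: "to_fract (p ^ n) = to_fract p ^ n"
  by (induction n) simp_all

lemma degree_power_idom: "degree (p ^ n) = n * degree (p :: 'a::idom poly)"
  by (cases "p = 0") (simp_all add: Polynomial.degree_power_eq power_0_left)

lemma to_fract_homog2:
  assumes B: "B \<noteq> 0" and D: "D \<noteq> 0" and a: "degX f \<le> a" and b: "degY f \<le> b"
  shows "to_fract (homog2 a b A B C D f) =
    to_fract (B ^ a * D ^ b) * subst2 const_fract (to_fract A / to_fract B) (to_fract C / to_fract D) f"
proof -
  have "to_fract (B ^ a * D ^ b) * (const_fract c * (to_fract A / to_fract B) ^ i * (to_fract C / to_fract D) ^ j)
      = to_fract (smult c (A ^ i * B ^ (a - i) * (C ^ j * D ^ (b - j))))"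
    if "i \<le> a" "j \<le> b" for c i j
  proof -
    have "to_fract B ^ a = to_fract B ^ (a - i) * to_fract B ^ i" "to_fract D ^ b = to_fract D ^ (b - j) * to_fract D ^ j"
      using that by (simp_all flip: power_add)
    moreover have "smult c p = [:c:] * p" for p by simp
    ultimately show ?thesis
      using B D by (simp only: to_fract_mult to_fract_power const_fract_def) (simp add: power_divide field_simps)
  qed
  then show ?thesis
    unfolding subst2_eq_sum[OF const_fract_hom a b] homog2_def
    by (simp add: sum_distrib_left flip: to_fract_sum)
qed

locale rational_curve =
  fixes A B C D :: "'a::field_gcd poly"
  assumes B: "B \<noteq> 0" and D: "D \<noteq> 0"
begin

definition restrict :: "'a poly poly \<Rightarrow> 'a poly fract"
  where "restrict = subst2 const_fract (to_fract A / to_fract B) (to_fract C / to_fract D)"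

lemmas restrict_simps = subst2_simps[OF const_fract_hom, of "to_fract A / to_fract B" "to_fract C / to_fract D", folded restrict_def]

lemma restrict_eq_0_iff_homog2:
  assumes "degX f \<le> a" "degY f \<le> b"
  shows "restrict f = 0 \<longleftrightarrow> homog2 a b A B C D f = 0"
proof -
  have "homog2 a b A B C D f = 0 \<longleftrightarrow> to_fract (homog2 a b A B C D f) = 0" by simp
  then show ?thesis
    unfolding to_fract_homog2[OF B D assms] restrict_def using B D by simp
qed

lemma homog2_shift2:
  assumes "degX f \<le> a" "degY f \<le> b"
  shows "homog2 a b A B C D f = homog2 a b (A - smult u B) B (C - smult v D) D (shift2 u v f)"
proof -
  have s: "degX (shift2 u v f) \<le> a" "degY (shift2 u v f) \<le> b"
    unfolding degX_le_iff degY_le_iff using assms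
    by (auto simp: coeff_shift2[OF assms] coeff_swap2 binomial_eq_0 intro!: sum.neutral)
  have e: "to_fract (A - smult u B) / to_fract B + const_fract u = to_fract A / to_fract B" 
    "to_fract (C - smult v D) / to_fract D + const_fract v = to_fract C / to_fract D"
  proof -
    have *: "smult c p = [:c:] * p" for c and p :: "'a poly" by simp
    show "to_fract (A - smult u B) / to_fract B + const_fract u = to_fract A / to_fract B" 
      "to_fract (C - smult v D) / to_fract D + const_fract v = to_fract C / to_fract D"
      unfolding * const_fract_def to_fract_mult to_fract_diff using B D by (simp_all add: field_simps)
  qed
  have "to_fract (homog2 a b A B C D f) = to_fract (homog2 a b (A - smult u B) B (C - smult v D) D (shift2 u v f))"
    unfolding to_fract_homog2[OF B D assms] to_fract_homog2[OF B D s]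
    unfolding subst2_shift2[OF const_fract_hom] e by simp
  then show ?thesis by simp
qed

text \<open>
  A zero of \<open>h\<close> is a parameter value at which the curve passes through \<open>(u, v)\<close>; the expansion around
  that point starts with terms of order \<open>mult2 u v f\<close>.
\<close>

lemma power_dvd_homog2_point:
  assumes "degX f \<le> a" "degY f \<le> b" "f \<noteq> 0"
    and A: "h dvd A - smult u B" and C: "h dvd C - smult v D"
  shows "h ^ mult2 u v f dvd homog2 a b A B C D f"
  unfolding homog2_shift2[OF assms(1,2), of u v] homog2_def[of a b _ _ _ _ "shift2 u v f"]
proof (intro dvd_sum)
  fix i j
  show "h ^ mult2 u v f dvd smult (coeff (coeff (shift2 u v f) i) j)
     ((A - smult u B) ^ i * B ^ (a - i) * ((C - smult v D) ^ j * D ^ (b - j)))"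
  proof (cases "i + j < mult2 u v f")
    case True
    then show ?thesis using mult2_ge_iff[OF \<open>f \<noteq> 0\<close>, of "mult2 u v f" u v] by simp
  next
    case False
    have "h ^ (i + j) dvd (A - smult u B) ^ i * (C - smult v D) ^ j"
      unfolding power_add by (intro mult_dvd_mono dvd_power_same A C)
    moreover have "h ^ mult2 u v f dvd h ^ (i + j)" using False by (intro le_imp_power_dvd) simp
    moreover have "(A - smult u B) ^ i * (C - smult v D) ^ j dvd
      (A - smult u B) ^ i * B ^ (a - i) * ((C - smult v D) ^ j * D ^ (b - j))"
      by (intro mult_dvd_mono) auto
    ultimately show ?thesis by (meson dvd_smult dvd_trans)
  qed
qed

text \<open>
  At a common zero of the two denominators the curve passes through \<open>(\<infinity>, \<infinity>)\<close>, where a polynomial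
  of bidegree \<open>(a, b)\<close> and total degree \<open>e\<close> has multiplicity at least \<open>a + b - e\<close>.
\<close>

lemma power_dvd_homog2_infinity:
  assumes "g dvd B" "g dvd D"
  shows "g ^ (a + b - degT f) dvd homog2 a b A B C D f"
  unfolding homog2_def
proof (intro dvd_sum)
  fix i j assume ij: "i \<in> {..a}" "j \<in> {..b}"
  show "g ^ (a + b - degT f) dvd smult (coeff (coeff f i) j) (A ^ i * B ^ (a - i) * (C ^ j * D ^ (b - j)))"
  proof (cases "degT f < i + j")
    case True
    then have "coeff (coeff f i) j = 0" using degT_le_iff[of f "degT f"] by simp
    then show ?thesis by simp
  next
    case False
    have "g ^ ((a - i) + (b - j)) dvd B ^ (a - i) * D ^ (b - j)"
      unfolding power_add by (intro mult_dvd_mono dvd_power_same assms)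
    moreover have "g ^ (a + b - degT f) dvd g ^ ((a - i) + (b - j))" using False ij by (intro le_imp_power_dvd) auto
    moreover have "B ^ (a - i) * D ^ (b - j) dvd A ^ i * B ^ (a - i) * (C ^ j * D ^ (b - j))"
      by (intro mult_dvd_mono) auto
    ultimately show ?thesis by (meson dvd_smult dvd_trans)
  qed
qed

lemma degree_homog2:
  assumes "degree A \<le> p" "degree B \<le> p" "degree C \<le> q" "degree D \<le> q"
  shows "degree (homog2 a b A B C D f) \<le> a * p + b * q"
  unfolding homog2_def
proof (intro degree_sum_le finite_atMost)
  fix i j assume ij: "i \<in> {..a}" "j \<in> {..b}"
  have pw: "degree (P ^ n) \<le> n * k" if "degree P \<le> k" for P :: "'a poly" and n k
    using degree_power_le[of P n] that by (metis le_trans mult.commute mult_le_mono2)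
  have "degree (A ^ i * B ^ (a - i) * (C ^ j * D ^ (b - j))) \<le> (i * p + (a - i) * p) + (j * q + (b - j) * q)"
    by (intro order_trans[OF degree_mult_le] add_mono pw assms)
  also have "\<dots> = a * p + b * q" using ij by (simp flip: add_mult_distrib)
  finally show "degree (smult (coeff (coeff f i) j) (A ^ i * B ^ (a - i) * (C ^ j * D ^ (b - j)))) \<le> a * p + b * q"
    using degree_smult_le order_trans by blast
qed

text \<open>
  The zeros that are forced at the points and at infinity belong to coprime factors, because the
  parametrisation maps a parameter value to one point only.  If they outnumber the degree of the
  restricted polynomial, then it is zero.
\<close>

lemma bezout:
  assumes deg: "degree A \<le> p" "degree B \<le> p" "degree C \<le> q" "degree D \<le> q"
    and cop: "coprime A B" "coprime C D"
    and I: "finite I" "inj_on (\<lambda>i. (u i, v i)) I"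
    and h: "\<And>i. i \<in> I \<Longrightarrow> h i dvd A - smult (u i) B" "\<And>i. i \<in> I \<Longrightarrow> h i dvd C - smult (v i) D"
    and g: "g dvd B" "g dvd D"
    and f: "f \<noteq> 0"
    and less: "degX f * p + degY f * q < (degX f + degY f - degT f) * degree g + (\<Sum>i\<in>I. mult2 (u i) (v i) f * degree (h i))"
  shows "restrict f = 0"
proof (rule ccontr)
  define P where "P = homog2 (degX f) (degY f) A B C D f"
  assume "restrict f \<noteq> 0"
  then have P0: "P \<noteq> 0" unfolding P_def using restrict_eq_0_iff_homog2[of f "degX f" "degY f"] by simp
  have aux: "coprime r s" if "coprime a b" "r dvd a - smult x b" "s dvd a - smult y b" "x \<noteq> y"
    for a b r s :: "'a poly" and x y
  proof (rule coprimeI)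
    fix d assume d: "d dvd r" "d dvd s"
    then have "d dvd (a - smult y b) - (a - smult x b)" using that by (meson dvd_diff dvd_trans)
    then have "d dvd smult (x - y) b" by (simp add: smult_diff_left)
    then have "d dvd b" using \<open>x \<noteq> y\<close> by (simp add: dvd_smult_iff)
    moreover have "d dvd (a - smult x b) + smult x b" using d that \<open>d dvd b\<close> by (intro dvd_add) (auto intro: dvd_trans dvd_smult)
    ultimately show "is_unit d" using that(1) by (simp add: coprime_def)
  qed
  have hh: "coprime (h i) (h j)" if "i \<in> I" "j \<in> I" "i \<noteq> j" for i j
    using inj_onD[OF I(2), of i j] that h aux[OF cop(1), of "h i" "u i" "h j" "u j"] aux[OF cop(2), of "h i" "v i" "h j" "v j"]
    by blast
  have gh: "coprime g (h i)" if "i \<in> I" for i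
  proof (rule coprimeI)
    fix d assume d: "d dvd g" "d dvd h i"
    then have "d dvd B" "d dvd A - smult (u i) B" using g h that by (auto intro: dvd_trans)
    then have "d dvd (A - smult (u i) B) + smult (u i) B" by (intro dvd_add) (auto intro: dvd_smult)
    with \<open>d dvd B\<close> show "is_unit d" using cop(1) by (simp add: coprime_def)
  qed
  have "(\<Prod>i\<in>J. h i ^ mult2 (u i) (v i) f) dvd P" if "J \<subseteq> I" for J
    using finite_subset[OF that I(1)] that
  proof (induction J rule: finite_induct)
    case (insert i J)
    have "coprime (h i ^ mult2 (u i) (v i) f) (\<Prod>i\<in>J. h i ^ mult2 (u i) (v i) f)"
      using insert hh by (intro prod_coprime_right) (auto simp: coprime_power_left_iff coprime_power_right_iff)
    moreover have "h i ^ mult2 (u i) (v i) f dvd P"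
      unfolding P_def using insert h f by (intro power_dvd_homog2_point) auto
    ultimately show ?case using insert by (simp add: divides_mult)
  qed simp
  moreover have "coprime (g ^ (degX f + degY f - degT f)) (\<Prod>i\<in>I. h i ^ mult2 (u i) (v i) f)"
    using gh by (intro prod_coprime_right) (auto simp: coprime_power_left_iff coprime_power_right_iff)
  moreover have "g ^ (degX f + degY f - degT f) dvd P"
    unfolding P_def by (rule power_dvd_homog2_infinity[OF g])
  ultimately have dvd: "g ^ (degX f + degY f - degT f) * (\<Prod>i\<in>I. h i ^ mult2 (u i) (v i) f) dvd P"
    by (simp add: divides_mult)
  then have "g ^ (degX f + degY f - degT f) \<noteq> 0" "(\<Prod>i\<in>I. h i ^ mult2 (u i) (v i) f) \<noteq> 0" using P0 by auto
  then have "degree (g ^ (degX f + degY f - degT f) * (\<Prod>i\<in>I. h i ^ mult2 (u i) (v i) f))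
    = (degX f + degY f - degT f) * degree g + (\<Sum>i\<in>I. mult2 (u i) (v i) f * degree (h i))"
    using I(1) by (simp add: degree_mult_eq degree_power_idom degree_prod_eq_sum_degree)
  moreover have "\<dots> \<le> degX f * p + degY f * q"
    using dvd_imp_degree_le[OF dvd P0] degree_homog2[OF deg, of "degX f" "degY f" f] calculation P_def by simp
  ultimately show False using less by simp
qed

end

context rational_curve
begin

text \<open>
  The powers \<open>1, x, \<dots>, x\<^sup>n\<^sup>-\<^sup>1\<close> are linearly independent over the rational functions in \<open>y\<close> on the curve
  if they are so on a single fibre \<open>y = const\<close>, given by the zeros of \<open>H\<close>: the coefficients of a
  relation vanish on that fibre, so the relation can be divided by the equation of the fibre, and
  this cannot be repeated indefinitely.
\<close>

lemma eq_0_if_restrict_eq_0: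
  assumes H: "H = C - smult y D" "H \<noteq> 0" "coprime H D"
    and indep: "\<And>r. degree r < n \<Longrightarrow> H dvd (\<Sum>i<n. smult (coeff r i) (A ^ i * B ^ (n - 1 - i))) \<Longrightarrow> r = 0"
    and R: "degX R < n" "restrict R = 0"
  shows "R = 0"
  using R
proof (induction "degY R" arbitrary: R rule: less_induct)
  case less
  define b where "b = degY R"
  define r where "r = map_poly (\<lambda>c. poly c y) R"
  have n: "{..n - 1} = {..<n}" using less.prems(1) by auto
  have "degX R \<le> n - 1" using less.prems(1) by simp
  then have 0: "homog2 (n - 1) b A B C D R = 0"
    using restrict_eq_0_iff_homog2[of R "n - 1" b] less.prems(2) by (simp add: b_def)
  have "H dvd C ^ j - smult y D ^ j" for j
    using power_diff_sumr2[of C j "smult y D"] H(1) by simp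
  then have "H dvd (\<Sum>i\<le>n-1. \<Sum>j\<le>b. smult (coeff (coeff R i) j) (A ^ i * B ^ (n - 1 - i) * ((C ^ j - smult y D ^ j) * D ^ (b - j))))"
    by (intro dvd_sum dvd_smult dvd_mult dvd_mult2)
  also have "\<dots> = homog2 (n - 1) b A B C D R - (\<Sum>i\<le>n-1. \<Sum>j\<le>b. smult (coeff (coeff R i) j * y ^ j) (A ^ i * B ^ (n - 1 - i) * D ^ b))"
  proof -
    have "smult c (P * ((C ^ j - smult y D ^ j) * D ^ (b - j))) = smult c (P * (C ^ j * D ^ (b - j))) - smult (c * y ^ j) (P * D ^ b)"
      if "j \<le> b" for c P j
    proof -
      have "D ^ b = D ^ j * D ^ (b - j)" using that by (simp flip: power_add)
      moreover have "smult y D ^ j = smult (y ^ j) (D ^ j)" by (induction j) (simp_all add: mult_ac)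
      ultimately show ?thesis by (simp add: algebra_simps smult_diff_right)
    qed
    then show ?thesis unfolding homog2_def by (simp add: sum_subtractf)
  qed
  also have "(\<Sum>i\<le>n-1. \<Sum>j\<le>b. smult (coeff (coeff R i) j * y ^ j) (A ^ i * B ^ (n - 1 - i) * D ^ b))
    = (\<Sum>i<n. smult (coeff r i) (A ^ i * B ^ (n - 1 - i))) * D ^ b"
  proof -
    have "poly (coeff R i) y = (\<Sum>j\<le>b. coeff (coeff R i) j * y ^ j)" for i
      using degree_coeff_le_swap2[of R i] by (intro poly_eq_sum_atMost) (simp add: b_def)
    then show ?thesis unfolding n by (simp add: r_def coeff_map_poly sum_distrib_right flip: smult_sum)
  qed
  finally have "H dvd (\<Sum>i<n. smult (coeff r i) (A ^ i * B ^ (n - 1 - i))) * D ^ b"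
    by (simp only: 0 diff_0 dvd_minus_iff)
  then have "H dvd (\<Sum>i<n. smult (coeff r i) (A ^ i * B ^ (n - 1 - i)))"
    using H(3) by (simp add: coprime_dvd_mult_left_iff coprime_power_right_iff)
  moreover have "degree r < n"
    using degree_map_poly_le[of "\<lambda>c. poly c y" R] less.prems(1) by (simp add: r_def)
  ultimately have "r = 0" by (rule indep[rotated])
  then have "poly (coeff R i) y = 0" for i
    by (metis r_def coeff_map_poly poly_0 coeff_0)
  then have "[:[:- y, 1:]:] dvd R"
    by (simp add: const_poly_dvd_iff poly_eq_0_iff_dvd)
  then obtain R' where R': "R = [:[:- y, 1:]:] * R'" by (elim dvdE)
  show ?case
  proof (cases "R = 0")
    case False
    with R' have "R' \<noteq> 0" by auto
    have L: "[:[:- y, 1:]:] = Y2 + const2 (- y)" by (simp add: const2_def)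
    have "swap2 [:[:- y, 1:]:] = X2 + const2 (- y)"
      unfolding L swap2_def by (simp only: subst2_simps[OF const2_hom])
    then have "degY [:[:- y, 1:]:] = 1" by (simp add: const2_def)
    then have "degY R' < degY R"
      using degY_mult[of "[:[:- y, 1:]:]" R'] \<open>R' \<noteq> 0\<close> R' by simp
    moreover have "degX R' = degX R"
      using degree_mult_eq[of "[:[:- y, 1:]:]" R'] \<open>R' \<noteq> 0\<close> R' by simp
    moreover have "restrict R' = 0"
    proof -
      have "restrict R = (to_fract C / to_fract D - const_fract y) * restrict R'"
        unfolding R' L by (simp only: restrict_simps) (simp add: const_fract_def flip: to_fract_uminus)
      moreover have "to_fract D * (to_fract C / to_fract D - const_fract y) = to_fract H"
      proof -
        have "to_fract H = to_fract C - const_fract y * to_fract D"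
          unfolding H(1) const_fract_def by (simp flip: to_fract_mult)
        moreover have "to_fract D * (to_fract C / to_fract D) = to_fract C" using D by simp
        ultimately show ?thesis by (simp only: right_diff_distrib mult.commute)
      qed
      ultimately show ?thesis using less.prems(2) H(2) by auto
    qed
    ultimately have "R' = 0" using less.hyps less.prems(1) by simp
    with \<open>R' \<noteq> 0\<close> show ?thesis by simp
  qed
qed

text \<open>
  Pseudodivision by \<open>G\<close> leaves a remainder to which the previous lemma applies, so that \<open>G\<close> divides
  over the field of rational functions in \<open>y\<close>; by Gauss's lemma it divides over the polynomials.
\<close>

lemma dvd_if_restrict_eq_0:
  assumes H: "H = C - smult y D" "H \<noteq> 0" "coprime H D"
    and indep: "\<And>r. degree r < degX G \<Longrightarrow> H dvd (\<Sum>i<degX G. smult (coeff r i) (A ^ i * B ^ (degX G - 1 - i))) \<Longrightarrow> r = 0"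
    and G: "0 < degX G" "content G = 1" "restrict G = 0"
    and f: "restrict f = 0"
  shows "G dvd f"
proof -
  define r where "r = pseudo_mod f G"
  have "G \<noteq> 0" using G(1) by auto
  from pseudo_mod[OF this, of f, folded r_def] obtain a q where aq: "a \<noteq> 0" "smult a f = G * q + r" and r: "r = 0 \<or> degree r < degree G" by metis
  have "restrict r = restrict ([:a:] * f) - restrict (G * q)"
    using restrict_simps(1)[of "G * q" r] aq(2) by simp
  also have "\<dots> = 0" by (simp only: restrict_simps f G) simp
  finally have "r = 0"
    using r eq_0_if_restrict_eq_0[OF H indep, where R = r] G(1) by fastforce
  then have "fract_poly G dvd fract_poly (smult a f)"
    using aq(2) by (metis add.right_neutral dvd_triv_left fract_poly_dvd)
  then have "fract_poly G dvd fract_poly f"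
    using aq(1) by (simp add: fract_poly_smult dvd_smult_iff)
  then show ?thesis using G(2) by (rule fract_poly_dvdD)
qed

end

text \<open>
  The intersection number, on the blow-up of \<open>P\<^sup>1 \<times> P\<^sup>1\<close>, of the curve \<open>f = 0\<close> with a curve that
  is parametrised by rational functions of degrees \<open>p\<close> and \<open>q\<close> and that has multiplicity \<open>r\<close> at
  \<open>(\<infinity>, \<infinity>)\<close> and \<open>m i\<close> at the points \<open>(u i, v i)\<close>.  The multiplicity of \<open>f\<close> itself at \<open>(\<infinity>, \<infinity>)\<close> is
  \<open>degX f + degY f - degT f\<close>.
\<close>

definition curve_class_pairing :: "nat \<Rightarrow> nat \<Rightarrow> nat \<Rightarrow> ('i \<Rightarrow> nat) \<Rightarrow> 'i set \<Rightarrow> ('i \<Rightarrow> 'a::idom) \<Rightarrow> ('i \<Rightarrow> 'a) \<Rightarrow> 'a poly poly \<Rightarrow> int"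
  where "curve_class_pairing p q r m I u v f =
    int (p * degX f) + int (q * degY f) - int r * (int (degX f) + int (degY f) - int (degT f))
      - (\<Sum>i\<in>I. int (m i * mult2 (u i) (v i) f))"

lemma curve_class_pairing_mult:
  assumes "f \<noteq> 0" "g \<noteq> 0"
  shows "curve_class_pairing p q r m I u v (f * g) = curve_class_pairing p q r m I u v f + curve_class_pairing p q r m I u v g"
  using assms unfolding curve_class_pairing_def
  by (simp add: degree_mult_eq degY_mult degT_mult mult2_mult algebra_simps sum.distrib)

lemma degT_le: "degT f \<le> degX f + degY f"
  unfolding degT_le_iff
  by (metis add_mono degX_le_iff degY_le_iff leD le_refl linorder_not_le)

lemma (in rational_curve) restrict_eq_0_if_pairing_neg:
  assumes deg: "degree A \<le> p" "degree B \<le> p" "degree C \<le> q" "degree D \<le> q"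
    and cop: "coprime A B" "coprime C D"
    and I: "finite I" "inj_on (\<lambda>i. (u i, v i)) I"
    and h: "\<And>i. i \<in> I \<Longrightarrow> h i dvd A - smult (u i) B" "\<And>i. i \<in> I \<Longrightarrow> h i dvd C - smult (v i) D"
      "\<And>i. i \<in> I \<Longrightarrow> degree (h i) = m i"
    and g: "g dvd B" "g dvd D" "degree g = r"
    and f: "f \<noteq> 0"
    and neg: "curve_class_pairing p q r m I u v f < 0"
  shows "restrict f = 0"
proof (rule bezout[OF deg cop I h(1,2) g(1,2) f])
  obtain k where k: "degX f + degY f = degT f + k" using degT_le[of f] le_iff_add by blast
  then have "int (degX f) + int (degY f) - int (degT f) = int k" by linarith
  then have *: "int (degX f * p + degY f * q) < int (k * r + (\<Sum>i\<in>I. mult2 (u i) (v i) f * m i))"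
    using neg unfolding curve_class_pairing_def by (simp add: mult.commute)
  have "degX f + degY f - degT f = k" using k by simp
  with *[unfolded of_nat_less_iff] show "degX f * p + degY f * q < (degX f + degY f - degT f) * degree g + (\<Sum>i\<in>I. mult2 (u i) (v i) f * degree (h i))"
    using h(3) by (simp add: g(3) cong: sum.cong_simp)
qed

text \<open>
  If the sum of two irreducible curves has nonnegative intersection with each of them, then it is nef:
  a curve with negative intersection with the sum contains one of the two, and removing it keeps the
  intersection negative.
\<close>

lemma nef_sum_of_two_curves:
  fixes N1 N2 :: "'a::idom poly poly \<Rightarrow> int"
  assumes add: "\<And>f g. f \<noteq> 0 \<Longrightarrow> g \<noteq> 0 \<Longrightarrow> N1 (f * g) = N1 f + N1 g"
      "\<And>f g. f \<noteq> 0 \<Longrightarrow> g \<noteq> 0 \<Longrightarrow> N2 (f * g) = N2 f + N2 g"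
    and dvd: "\<And>f. f \<noteq> 0 \<Longrightarrow> N1 f < 0 \<Longrightarrow> G1 dvd f" "\<And>f. f \<noteq> 0 \<Longrightarrow> N2 f < 0 \<Longrightarrow> G2 dvd f"
    and deg: "0 < degX G1" "0 < degX G2"
    and nonneg: "0 \<le> N1 G1 + N2 G1" "0 \<le> N1 G2 + N2 G2"
    and f: "f \<noteq> 0"
  shows "0 \<le> N1 f + N2 f"
  using f
proof (induction "degX f" arbitrary: f rule: less_induct)
  case less
  show ?case
  proof (rule ccontr)
    assume neg: "\<not> ?thesis"
    then have "N1 f < 0 \<or> N2 f < 0" by auto
    then obtain G where G: "G dvd f" "0 < degX G" "0 \<le> N1 G + N2 G"
      using dvd[OF less.prems] deg nonneg by blast
    then obtain f' where f': "f = G * f'" by (elim dvdE)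
    with less.prems have "G \<noteq> 0" "f' \<noteq> 0" by auto
    then have "degX f' < degX f" using G(2) f' by (simp add: degree_mult_eq)
    then have "0 \<le> N1 f' + N2 f'" using less.hyps \<open>f' \<noteq> 0\<close> by blast
    then show False using neg G(3) add[OF \<open>G \<noteq> 0\<close> \<open>f' \<noteq> 0\<close>] f' by simp
  qed
qed

section \<open>Reduction of integral certificates modulo a prime\<close>

text \<open>
  A test on coefficient lists that the simplifier decides for explicit polynomials.
\<close>

definition cong_poly :: "int \<Rightarrow> int poly \<Rightarrow> int poly \<Rightarrow> bool"
  where "cong_poly p P Q \<longleftrightarrow> (\<forall>c\<in>set (coeffs (P - Q)). p dvd c)"

definition reduce2 :: "int poly poly \<Rightarrow> 'a::comm_ring_1 poly poly"
  where "reduce2 = map_poly of_int_poly"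

lemma coeff_reduce2: "coeff (coeff (reduce2 G) i) j = of_int (coeff (coeff G i) j)"
  by (simp add: reduce2_def coeff_map_poly)

lemma of_int_poly_eq_if_cong:
  assumes "cong_poly (int CHAR('a::comm_ring_1)) P Q"
  shows "of_int_poly P = (of_int_poly Q :: 'a poly)"
proof (rule poly_eqI)
  fix i
  have "coeff (P - Q) i \<in> insert 0 (set (coeffs (P - Q)))" using range_coeff by blast
  then have "int CHAR('a) dvd coeff P i - coeff Q i" using assms by (auto simp: cong_poly_def)
  then have "(of_int (coeff P i - coeff Q i) :: 'a) = 0" by (simp only: of_int_eq_0_iff_char_dvd)
  then show "coeff (of_int_poly P :: 'a poly) i = coeff (of_int_poly Q) i" by simp
qed

definition hasse2 :: "nat \<Rightarrow> nat \<Rightarrow> 'a::comm_ring_1 poly poly \<Rightarrow> 'a \<Rightarrow> 'a \<Rightarrow> nat \<Rightarrow> nat \<Rightarrow> 'a"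
  where "hasse2 m n f u v p q = (\<Sum>i\<le>m. \<Sum>j\<le>n.
    coeff (coeff f i) j * of_nat (i choose p) * of_nat (j choose q) * u ^ (i - p) * v ^ (j - q))"

lemma degX_reduce2_le: "degX (reduce2 G) \<le> degX G"
  by (simp add: reduce2_def degree_map_poly_le)

lemma degY_reduce2_le:
  assumes "\<forall>i\<le>degX G. degree (coeff G i) \<le> b"
  shows "degY (reduce2 G) \<le> b"
  unfolding degY_le_iff coeff_reduce2
proof (intro allI impI)
  fix i j assume "b < j"
  then have "coeff (coeff G i) j = 0"
    using assms by (cases "i \<le> degX G") (auto intro: coeff_eq_0 simp: coeff_eq_0)
  then show "of_int (coeff (coeff G i) j) = 0" by simp
qed

lemma degX_reduce2:
  assumes "\<not> int CHAR('a::comm_ring_1) dvd coeff (coeff G (degX G)) j"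
  shows "degX (reduce2 G :: 'a poly poly) = degX G"
proof (intro antisym degX_reduce2_le le_degree)
  have "coeff (coeff (reduce2 G :: 'a poly poly) (degX G)) j \<noteq> 0"
    using assms by (simp add: coeff_reduce2 of_int_eq_0_iff_char_dvd)
  then show "coeff (reduce2 G :: 'a poly poly) (degX G) \<noteq> 0" by auto
qed

lemma degY_reduce2:
  assumes "\<forall>i\<le>degX G. degree (coeff G i) \<le> b" "\<not> int CHAR('a::comm_ring_1) dvd coeff (coeff G i) b"
  shows "degY (reduce2 G :: 'a poly poly) = b"
proof (intro antisym degY_reduce2_le assms le_degree)
  have "coeff (coeff (swap2 (reduce2 G :: 'a poly poly)) b) i \<noteq> 0"
    using assms by (simp add: coeff_reduce2 coeff_swap2 of_int_eq_0_iff_char_dvd)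
  then show "coeff (swap2 (reduce2 G :: 'a poly poly)) b \<noteq> 0" by auto
qed

lemma degT_reduce2:
  assumes "\<forall>i\<le>degX G. degree (coeff G i) \<le> c - i" "degX G \<le> c"
    and "i \<le> c" "\<not> int CHAR('a::comm_ring_1) dvd coeff (coeff G i) (c - i)"
  shows "degT (reduce2 G :: 'a poly poly) = c"
proof (intro antisym le_degree)
  show "degT (reduce2 G :: 'a poly poly) \<le> c"
    unfolding degT_le_iff coeff_reduce2
  proof (intro allI impI)
    fix i j assume ij: "c < i + j"
    have "coeff (coeff G i) j = 0"
    proof (cases "i \<le> degX G")
      case True
      then have "degree (coeff G i) < j" using assms(1,2) ij by fastforce
      then show ?thesis by (rule coeff_eq_0)
    qed (simp add: coeff_eq_0)
    then show "of_int (coeff (coeff G i) j) = (0::'a)" by simp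
  qed
  show "coeff (fan2 (reduce2 G :: 'a poly poly)) c \<noteq> 0"
  proof -
    have "coeff (coeff (reduce2 G :: 'a poly poly) i) (c - i) \<noteq> 0"
      using assms(4) by (simp add: coeff_reduce2 of_int_eq_0_iff_char_dvd)
    then show ?thesis using assms(3) coeff_fan2_eq_0_iff le_add_diff_inverse by blast
  qed
qed

lemma coeff_shift2_reduce2:
  assumes "degX G \<le> a" "\<forall>i\<le>degX G. degree (coeff G i) \<le> b"
  shows "coeff (coeff (shift2 (of_int u) (of_int v) (reduce2 G :: 'a::comm_ring_1 poly poly)) r) s
    = of_int (hasse2 a b G u v r s)"
  using coeff_shift2[of "reduce2 G :: 'a poly poly" a b "of_int u" "of_int v" r s]
    degX_reduce2_le[of G, where ?'a = 'a] degY_reduce2_le[OF assms(2), where ?'a = 'a] assms(1)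
  by (simp add: coeff_reduce2 hasse2_def)

lemma mult2_reduce2:
  assumes G: "degX G \<le> a" "\<forall>i\<le>degX G. degree (coeff G i) \<le> b"
    and zero: "\<forall>r<c. \<forall>s<c - r. int CHAR('a::idom) dvd hasse2 a b G u v r s"
    and nonzero: "\<exists>r\<le>c. \<not> int CHAR('a) dvd hasse2 a b G u v r (c - r)"
  shows "mult2 (of_int u) (of_int v) (reduce2 G :: 'a poly poly) = c"
proof -
  let ?G = "reduce2 G :: 'a poly poly"
  note [simp] = coeff_shift2_reduce2[OF G] of_int_eq_0_iff_char_dvd
  obtain r where r: "r \<le> c" "\<not> int CHAR('a) dvd hasse2 a b G u v r (c - r)" using nonzero by blast
  have "?G \<noteq> 0"
  proof
    assume 0: "?G = 0"
    have "coeff (coeff (shift2 (of_int u) (of_int v) ?G) r) (c - r) = 0"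
      unfolding 0 by (simp add: shift2_def subst2_zero[OF const2_hom])
    with r(2) show False by simp
  qed
  note ge = mult2_ge_iff[OF this, of _ "of_int u" "of_int v"]
  have "c \<le> mult2 (of_int u) (of_int v) ?G"
    unfolding ge using zero by (auto simp: less_diff_conv add.commute)
  moreover have "\<not> Suc c \<le> mult2 (of_int u) (of_int v) ?G"
  proof
    assume "Suc c \<le> mult2 (of_int u) (of_int v) ?G"
    then have "coeff (coeff (shift2 (of_int u) (of_int v) ?G) r) (c - r) = 0"
      unfolding ge using r(1) by auto
    with r(2) show False by simp
  qed
  ultimately have "mult2 (of_int u) (of_int v) ?G = c" by simp
  then show ?thesis by simp
qed

text \<open>
  Independence modulo \<open>H\<close> of a family of polynomials \<open>P i\<close>, certified by remainders \<open>M i\<close> of small degree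
  and an inverse \<open>W\<close> of their coefficient matrix.
\<close>

lemma residues_independent:
  fixes H :: "'a::field_gcd poly"
  assumes M: "\<And>i. i < n \<Longrightarrow> H dvd P i - M i" "\<And>i. i < n \<Longrightarrow> degree (M i) < degree H"
    and W: "\<And>i l. i < n \<Longrightarrow> l < n \<Longrightarrow> (\<Sum>c<n. W l c * coeff (M i) c) = (if i = l then 1 else 0)"
    and r: "degree r < n" "H dvd (\<Sum>i<n. smult (coeff r i) (P i))"
  shows "r = 0"
proof -
  define S where "S = (\<Sum>i<n. smult (coeff r i) (M i))"
  have "(\<Sum>i<n. smult (coeff r i) (P i)) - S = (\<Sum>i<n. smult (coeff r i) (P i - M i))"
    by (simp add: S_def sum_subtractf smult_diff_right)
  moreover have "H dvd \<dots>" using M(1) by (intro dvd_sum dvd_smult) auto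
  ultimately have "H dvd (\<Sum>i<n. smult (coeff r i) (P i)) - ((\<Sum>i<n. smult (coeff r i) (P i)) - S)"
    using r(2) by (metis dvd_diff)
  then have "H dvd S" by simp
  moreover have "degree S < degree H"
  proof -
    have "0 < degree H" using M(2)[of 0] r(1) by (cases n) auto
    then show ?thesis unfolding S_def
      using M(2) by (intro degree_sum_less) (auto intro: le_less_trans[OF degree_smult_le])
  qed
  ultimately have S: "S = 0" by (metis dvd_imp_degree_le not_less)
  have "coeff r l = 0" for l
  proof (cases "l < n")
    case True
    have "0 = (\<Sum>c<n. W l c * coeff S c)" by (simp add: S)
    also have "\<dots> = (\<Sum>c<n. \<Sum>i<n. W l c * (coeff r i * coeff (M i) c))"
      by (simp add: S_def coeff_sum sum_distrib_left)
    also have "\<dots> = (\<Sum>i<n. coeff r i * (\<Sum>c<n. W l c * coeff (M i) c))"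
      by (subst sum.swap) (simp add: sum_distrib_left mult_ac)
    also have "\<dots> = (\<Sum>i<n. if i = l then coeff r i else 0)"
      using W True by (intro sum.cong) auto
    also have "\<dots> = coeff r l" using True by simp
    finally show ?thesis by simp
  qed (use r(1) in \<open>simp add: coeff_eq_0\<close>)
  then show ?thesis by (intro poly_eqI) simp
qed

text \<open>
  Integral data that determine, after reduction modulo \<open>p\<close>, a rational curve \<open>(A/B, C/D)\<close> with
  equation \<open>G\<close>.  The zeros of \<open>h i\<close> are the parameter values over the point \<open>(u i, v i)\<close>, with cofactors
  \<open>s i\<close> and \<open>t i\<close>, and those of \<open>g\<close> lie over \<open>(\<infinity>, \<infinity>)\<close>, with cofactors \<open>B'\<close> and \<open>D'\<close>.  The polynomials
  \<open>U\<close>, \<open>V\<close> and their primed versions are Bezout coefficients, and so are \<open>K1\<close> and \<open>K2\<close> for two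
  coefficients of \<open>G\<close>, which shows that \<open>G\<close> is primitive.  On the fibre over \<open>y\<close>, which is the zero set
  of \<open>H\<close>, the independence of the powers of \<open>A/B\<close> is certified by quotients \<open>Q i\<close>, remainders \<open>M i\<close> and
  an inverse matrix \<open>W\<close>.
\<close>

locale curve_certificate =
  fixes p :: int and a b n k :: nat
    and A B C D g B' D' H U V U' V' U'' V'' :: "int poly" and y :: int
    and u v :: "nat \<Rightarrow> int" and h s t M Q :: "nat \<Rightarrow> int poly" and W :: "nat \<Rightarrow> nat \<Rightarrow> int"
    and G :: "int poly poly" and i1 i2 :: nat and K1 K2 :: "int poly"
  assumes degree: "degree A \<le> a" "degree B \<le> a" "degree C \<le> b" "degree D \<le> b"
    and nonzero: "\<not> p dvd lead_coeff B" "\<not> p dvd lead_coeff D" "\<not> p dvd lead_coeff H"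
    and coprime: "cong_poly p (U * A + V * B) 1" "cong_poly p (U' * C + V' * D) 1" "cong_poly p (U'' * H + V'' * D) 1"
    and infinity: "cong_poly p B (g * B')" "cong_poly p D (g * D')" "lead_coeff g = 1"
    and points: "\<forall>i<k. cong_poly p (A - smult (u i) B) (h i * s i)"
      "\<forall>i<k. cong_poly p (C - smult (v i) D) (h i * t i)" "\<forall>i<k. lead_coeff (h i) = 1"
    and distinct: "\<forall>i<k. \<forall>j<k. p dvd u i - u j \<and> p dvd v i - v j \<longrightarrow> i = j"
    and fibre: "H = C - smult y D" "\<forall>i<n. cong_poly p (A ^ i * B ^ (n - 1 - i)) (H * Q i + M i)" "\<forall>i<n. degree (M i) < degree H"
      "\<forall>i<n. \<forall>l<n. p dvd (\<Sum>c<n. W l c * coeff (M i) c) - (if i = l then 1 else 0)"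
    and equation: "0 < n" "degX G = n" "\<not> p dvd lead_coeff (lead_coeff G)"
      "cong_poly p (K1 * coeff G i1 + K2 * coeff G i2) 1"
begin

text \<open>
  That \<open>G\<close> vanishes on the parametrised curve need not be part of the certificate: if the
  self-intersection is negative, it follows from \<open>bezout\<close> applied to \<open>G\<close>.
\<close>

lemma reduction_dvd:
  fixes f :: "'a::field_gcd poly poly"
  assumes p: "int CHAR('a) = p"
  defines "N \<equiv> curve_class_pairing a b (degree g) (\<lambda>i. degree (h i)) {..<k} (\<lambda>i. of_int (u i) :: 'a) (\<lambda>i. of_int (v i))"
  assumes self: "N (reduce2 G) < 0" and f: "f \<noteq> 0" "N f < 0"
  shows "reduce2 G dvd f"
proof -
  define r :: "int poly \<Rightarrow> 'a poly" where "r = of_int_poly"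
  have eq: "r P = r Q" if "cong_poly p P Q" for P Q
    using that of_int_poly_eq_if_cong[where ?'a = 'a, of P Q] by (simp add: p r_def)
  have hom: "r (P + Q) = r P + r Q" "r (P - Q) = r P - r Q" "r (P * Q) = r P * r Q" "r (P ^ m) = r P ^ m"
     "r (smult c P) = smult (of_int c) (r P)" "r 1 = 1" for P Q c m
    by (simp_all add: r_def hom_distribs)
  have deg_le: "degree (r P) \<le> degree P" for P by (simp add: r_def degree_map_poly_le)
  have deg_eq: "degree (r P) = degree P" if "\<not> p dvd lead_coeff P" for P
  proof (rule antisym[OF deg_le le_degree])
    show "coeff (r P) (degree P) \<noteq> 0" using that by (simp add: r_def of_int_eq_0_iff_char_dvd p)
  qed
  have nz: "r P \<noteq> 0" if "\<not> p dvd lead_coeff P" for P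
  proof
    assume "r P = 0"
    then have "coeff (r P) (degree P) = 0" by simp
    then show False using that by (simp add: r_def of_int_eq_0_iff_char_dvd p)
  qed
  have p1: "\<not> p dvd 1" using p of_int_eq_0_iff_char_dvd[where ?'a = 'a, of 1] by simp
  have cop: "coprime (r P) (r Q)" if "cong_poly p (X * P + Y * Q) 1" for X Y P Q
  proof (rule coprimeI)
    fix d assume "d dvd r P" "d dvd r Q"
    then have "d dvd r X * r P + r Y * r Q" by simp
    then show "is_unit d" using eq[OF that] by (simp add: hom)
  qed
  interpret rational_curve "r A" "r B" "r C" "r D"
    by unfold_locales (use nz nonzero in auto)
  have neg: "restrict f' = 0" if "f' \<noteq> 0" "N f' < 0" for f'
  proof (rule restrict_eq_0_if_pairing_neg[where h = "\<lambda>i. r (h i)" and g = "r g"])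
    show "degree (r A) \<le> a" "degree (r B) \<le> a" "degree (r C) \<le> b" "degree (r D) \<le> b"
      using degree deg_le order_trans by blast+
    show "inj_on (\<lambda>i. (of_int (u i) :: 'a, of_int (v i) :: 'a)) {..<k}"
    proof (rule inj_onI)
      fix i j assume "i \<in> {..<k}" "j \<in> {..<k}" "(of_int (u i) :: 'a, of_int (v i) :: 'a) = (of_int (u j), of_int (v j))"
      then have "of_int (u i - u j) = (0 :: 'a)" "of_int (v i - v j) = (0 :: 'a)" by simp_all
      then have "p dvd u i - u j" "p dvd v i - v j" unfolding of_int_eq_0_iff_char_dvd p .
      then show "i = j" using distinct \<open>i \<in> _\<close> \<open>j \<in> _\<close> by blast
    qed
    show "r (h i) dvd r A - smult (of_int (u i)) (r B)" "r (h i) dvd r C - smult (of_int (v i)) (r D)" if "i \<in> {..<k}" for i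
      using eq[OF points(1)[rule_format, of i]] eq[OF points(2)[rule_format, of i]] that by (auto simp: hom)
    show "degree (r (h i)) = degree (h i)" if "i \<in> {..<k}" for i
      using points(3) that p1 by (intro deg_eq) auto
    show "degree (r g) = degree g" using infinity(3) p1 by (intro deg_eq) simp
    show "r g dvd r B" "r g dvd r D" using eq[OF infinity(1)] eq[OF infinity(2)] by (simp_all add: hom)
    show "curve_class_pairing a b (degree g) (\<lambda>i. degree (h i)) {..<k} (\<lambda>i. of_int (u i)) (\<lambda>i. of_int (v i)) f' < 0"
      using that(2) by (simp add: N_def)
  qed (use cop coprime that in auto)
  have G: "degX (reduce2 G :: 'a poly poly) = n" 
    using equation(2,3) degX_reduce2[where ?'a = 'a, of G] p by metis
  show ?thesis
  proof (rule dvd_if_restrict_eq_0)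
    show "r H = r C - smult (of_int y) (r D)" unfolding fibre(1) by (simp add: hom)
    show "r H \<noteq> 0" using nz nonzero by blast
    show "coprime (r H) (r D)" using cop coprime by blast
    show "0 < degX (reduce2 G :: 'a poly poly)" using G equation(1) by simp
    show "restrict (reduce2 G) = 0"
      using neg[OF _ self] G equation(1) by fastforce
    show "restrict f = 0" using neg f by blast
    show "content (reduce2 G :: 'a poly poly) = 1"
    proof -
      have "content (reduce2 G :: 'a poly poly) dvd r (coeff G i)" for i
        using content_dvd_coeff[of "reduce2 G :: 'a poly poly" i] by (simp add: reduce2_def coeff_map_poly r_def)
      then have "content (reduce2 G :: 'a poly poly) dvd r K1 * r (coeff G i1) + r K2 * r (coeff G i2)" by simp
      then have "is_unit (content (reduce2 G :: 'a poly poly))" using eq[OF equation(4)] by (simp add: hom)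
      then show ?thesis by (metis is_unit_normalize normalize_content)
    qed
    fix q :: "'a poly"
    assume q: "degree q < degX (reduce2 G :: 'a poly poly)"
      "r H dvd (\<Sum>i<degX (reduce2 G :: 'a poly poly). smult (coeff q i) (r A ^ i * r B ^ (degX (reduce2 G :: 'a poly poly) - 1 - i)))"
    show "q = 0"
    proof (rule residues_independent[where n = n and H = "r H" and P = "\<lambda>i. r A ^ i * r B ^ (n - 1 - i)" and M = "\<lambda>i. r (M i)" and W = "\<lambda>l c. of_int (W l c)"])
      show "r H dvd r A ^ i * r B ^ (n - 1 - i) - r (M i)" if "i < n" for i
        using eq[OF fibre(2)[rule_format, OF that]] by (simp add: hom)
      show "degree (r (M i)) < degree (r H)" if "i < n" for i
        using fibre(3) that deg_eq[OF nonzero(3)] deg_le[of "M i"] by (metis le_less_trans)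
      show "(\<Sum>c<n. of_int (W l c) * coeff (r (M i)) c) = (if i = l then 1 else 0 :: 'a)" if "i < n" "l < n" for i l
      proof -
        have "(of_int ((\<Sum>c<n. W l c * coeff (M i) c) - (if i = l then 1 else 0)) :: 'a) = 0"
          using fibre(4) that unfolding of_int_eq_0_iff_char_dvd p by blast
        then show ?thesis by (simp add: r_def split: if_splits)
      qed
    qed (use q G in auto)
  qed
qed

end

section \<open>Two curves over the field with 13 elements\<close>

lemma coeff_pCons_numeral: "coeff (pCons a q) (numeral k) = coeff q (pred_numeral k)"
  by (simp add: numeral_eq_Suc)

lemma all_less_numerals:
  "(\<forall>i<8::nat. P i) \<longleftrightarrow> P 0 \<and> P 1 \<and> P 2 \<and> P 3 \<and> P 4 \<and> P 5 \<and> P 6 \<and> P 7"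
  "(\<forall>i<4::nat. P i) \<longleftrightarrow> P 0 \<and> P 1 \<and> P 2 \<and> P 3"
  "(\<forall>i<3::nat. P i) \<longleftrightarrow> P 0 \<and> P 1 \<and> P 2"
  "(\<forall>i<2::nat. P i) \<longleftrightarrow> P 0 \<and> P 1"
  by (simp_all add: eval_nat_numeral All_less_Suc conj_ac)
lemma all_le4:
  "(\<forall>i\<le>4::nat. P i) \<longleftrightarrow> P 0 \<and> P 1 \<and> P 2 \<and> P 3 \<and> P 4"
  by (simp add: eval_nat_numeral All_less_Suc conj_ac flip: less_Suc_eq_le)

lemma ex_le_numerals:
  "(\<exists>i\<le>3::nat. P i) \<longleftrightarrow> P 0 \<or> P 1 \<or> P 2 \<or> P 3"
  "(\<exists>i\<le>2::nat. P i) \<longleftrightarrow> P 0 \<or> P 1 \<or> P 2"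
  by (simp_all add: eval_nat_numeral Ex_less_Suc disj_ac flip: less_Suc_eq_le)

lemma sum_numerals:
  "(\<Sum>i<4::nat. f i) = f 0 + f 1 + f 2 + f 3"
  "(\<Sum>i\<le>4::nat. f i) = f 0 + f 1 + f 2 + f 3 + f 4"
  "(\<Sum>i\<le>5::nat. f i) = f 0 + f 1 + f 2 + f 3 + f 4 + f 5" for f :: "nat \<Rightarrow> int"
  by (simp_all add: eval_nat_numeral)

lemma small_binomials: "3 choose 2 = (3::nat)" "4 choose 2 = (6::nat)" "5 choose 2 = (10::nat)"
    "4 choose 3 = (4::nat)" "5 choose 3 = (10::nat)"
  by (simp_all add: eval_nat_numeral)

lemmas certificate_simps = small_binomials cong_poly_def one_pCons coeff_pCons_numeral all_less_numerals all_le4 ex_le_numerals sum_numerals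
  binomial_eq_0 power2_eq_square power3_eq_cube

text \<open>
  The eight affine points; the ninth point is \<open>(\<infinity>, \<infinity>)\<close>.  Through general points neither of the two
  curves below exists: each of them imposes one condition on the nine points by its existence and a
  second one by having a further double point.
\<close>

definition special_x :: "nat \<Rightarrow> int" where "special_x i = [7, 11, 12, 10, 6, 8, 9, 3] ! i"
definition special_y :: "nat \<Rightarrow> int" where "special_y i = [10, 8, 9, 1, 6, 3, 11, 4] ! i"

text \<open>
  The curve \<open>N\<^sub>1\<close>, with its triple point at the point of index 5.
\<close>

definition curve1 :: "int poly poly" where "curve1 =
  [:[:5, 9, 3, 8, 0, 6:],
   [:0, 8, 11, 5, 1, 5:],
   [:4, 4, 12, 3, 10, 1:],
   [:5, 7, 0, 11, 1, 0:],
   [:3, 5, 12, 1, 0, 0:]:]"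

definition preimage1 :: "nat \<Rightarrow> int poly" where "preimage1 i =
  [[:7, 2, 1:], [:3, 0, 1:], [:11, 0, 1:], [:9, 11, 1:], [:0, 11, 1:], [:10, 12, 8, 1:], [:1, 8, 1:], [:11, 1, 1:]] ! i"

interpretation curve1: curve_certificate where
  p = 13
  and a = 5
  and b = 4
  and n = 4
  and k = 8
  and A = "[:10, 2, 0, 4, 1, 10:]"
  and B = "[:6, 0, 3, 12, 0, 1:]"
  and C = "[:4, 5, 7, 10, 8:]"
  and D = "[:5, 8, 1, 1:]"
  and g = "[:7, 4, 1:]"
  and B' = "[:12, 8, 9, 1:]"
  and D' = "[:10, 1:]"
  and H = "[:4, 5, 7, 10, 8:] - smult 2 [:5, 8, 1, 1:]"
  and U = "[:11, 12, 11, 0, 4:]"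
  and V = "[:10, 11, 3, 9, 12:]"
  and U' = "[:12, 12, 9:]"
  and V' = "[:1, 8, 3, 6:]"
  and U'' = "[:12, 12, 9:]"
  and V'' = "[:12, 6, 8, 6:]"
  and y = 2
  and u = special_x
  and v = special_y
  and h = preimage1
  and s = "\<lambda>i. [[:1, 0, 8, 3:], [:3, 5, 1, 12:], [:5, 12, 1, 11:], [:6, 3, 1:], [:12, 2, 9, 4:], [:4, 11, 2:], [:8, 3, 6, 1:], [:4, 1, 7, 7:]] ! i"
  and t = "\<lambda>i. [[:12, 10, 8:], [:1, 2, 8:], [:1, 1, 8:], [:10, 12, 8:], [:2, 7, 8:], [:8, 8:], [:1, 0, 8:], [:8, 11, 8:]] ! i"
  and M = "\<lambda>i. [[:3, 3, 5, 0:], [:12, 2, 7, 8:], [:10, 7, 0, 12:], [:0, 0, 6, 10:]] ! i"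
  and Q = "\<lambda>i. [[:10, 6, 7, 4, 8, 6, 5, 7, 8, 8, 8, 5:],
      [:7, 8, 6, 12, 12, 5, 8, 10, 3, 2, 7, 11:],
      [:10, 10, 1, 10, 6, 12, 4, 6, 6, 12, 3, 6:],
      [:11, 12, 5, 0, 11, 1, 5, 4, 5, 12, 10, 8:]] ! i"
  and W = "\<lambda>i j. [[2, 10, 6, 12], [1, 11, 11, 9], [10, 2, 11, 9], [8, 7, 4, 12]] ! i ! j"
  and G = curve1
  and i1 = 4
  and i2 = 3
  and K1 = "[:2, 8, 4, 4:]"
  and K2 = "[:12, 5, 9:]"
  by unfold_locales (simp_all add: certificate_simps special_x_def special_y_def curve1_def preimage1_def)

lemma curve1_invariants:
  assumes p: "int CHAR('a::idom) = 13"
  shows "degX (reduce2 curve1 :: 'a poly poly) = 4" "degY (reduce2 curve1 :: 'a poly poly) = 5"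
    "degT (reduce2 curve1 :: 'a poly poly) = 7"
    "i < 8 \<Longrightarrow> mult2 (of_int (special_x i)) (of_int (special_y i)) (reduce2 curve1 :: 'a poly poly) = (if i = 5 then 3 else 2)"
proof -
  have d: "degX curve1 = 4" by (simp add: curve1_def)
  have "\<forall>i\<le>4. degree (coeff curve1 i) \<le> 5" "\<forall>i\<le>4. degree (coeff curve1 i) \<le> 7 - i"
    by (simp_all add: certificate_simps curve1_def)
  then have a: "degX curve1 = 4" "\<forall>i\<le>degX curve1. degree (coeff curve1 i) \<le> 5"
     "\<forall>i\<le>degX curve1. degree (coeff curve1 i) \<le> 7 - i"
    by (simp_all only: d)
  have "\<not> 13 dvd coeff (coeff curve1 (degX curve1)) 3" "\<not> 13 dvd coeff (coeff curve1 2) 5" "\<not> 13 dvd coeff (coeff curve1 2) (7 - 2)"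
    by (simp_all add: certificate_simps curve1_def)
  then show "degX (reduce2 curve1 :: 'a poly poly) = 4" "degY (reduce2 curve1 :: 'a poly poly) = 5" "degT (reduce2 curve1 :: 'a poly poly) = 7"
    using degX_reduce2[where ?'a = 'a, of curve1 3] degY_reduce2[where ?'a = 'a, of curve1 5 2] degT_reduce2[where ?'a = 'a, of curve1 7 2] a p
    by simp_all
  have m: "\<forall>i<8. \<forall>r<(if i = 5 then 3 else 2). \<forall>s<(if i = 5 then 3 else 2) - r. 13 dvd hasse2 4 5 curve1 (special_x i) (special_y i) r s"
    by (simp only: all_less_numerals(1), intro conjI; simp add: certificate_simps special_x_def special_y_def)
      (simp_all add: certificate_simps hasse2_def curve1_def)
  have m': "\<forall>i<8. \<exists>r\<le>(if i = 5 then 3 else 2). \<not> 13 dvd hasse2 4 5 curve1 (special_x i) (special_y i) r ((if i = 5 then 3 else 2) - r)"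
    by (simp only: all_less_numerals(1), intro conjI; simp add: certificate_simps special_x_def special_y_def)
      (simp_all add: certificate_simps hasse2_def curve1_def)
  show "mult2 (of_int (special_x i)) (of_int (special_y i)) (reduce2 curve1 :: 'a poly poly) = (if i = 5 then 3 else 2)" if "i < 8"
    using m[rule_format, OF that] m'[rule_format, OF that] a by (intro mult2_reduce2[where a = 4 and b = 5]) (simp_all add: p)
qed

text \<open>
  The curve \<open>N\<^sub>2\<close> after the exchange of the coordinates, so that it has the same bidegree as \<open>N\<^sub>1\<close>.
  Its triple point is the point of index 6.
\<close>

definition curve2 :: "int poly poly" where "curve2 =
  [:[:12, 12, 11, 4, 0, 1:],
   [:9, 1, 5, 10, 1, 11:],
   [:2, 0, 6, 0, 9, 9:],
   [:7, 3, 9, 8, 8, 0:],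
   [:7, 9, 11, 1, 0, 0:]:]"

definition preimage2 :: "nat \<Rightarrow> int poly" where "preimage2 i =
  [[:4, 7, 1:], [:2, 0, 1:], [:12, 0, 1:], [:11, 6, 1:], [:1, 5, 1:], [:0, 3, 1:], [:10, 2, 12, 1:], [:12, 3, 1:]] ! i"

interpretation curve2: curve_certificate where
  p = 13
  and a = 5
  and b = 4
  and n = 4
  and k = 8
  and A = "[:3, 3, 6, 5, 0, 6:]"
  and B = "[:1, 0, 12, 3, 1:]"
  and C = "[:6, 9, 5, 4, 10:]"
  and D = "[:4, 2, 0, 11, 1:]"
  and g = "[:8, 8, 1:]"
  and B' = "[:5, 8, 1:]"
  and D' = "[:7, 3, 1:]"
  and H = "[:6, 9, 5, 4, 10:] - smult 0 [:4, 2, 0, 11, 1:]"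
  and U = "[:3, 10, 7, 6:]"
  and V = "[:5, 0, 1, 1, 3:]"
  and U' = "[:10, 0, 8, 10:]"
  and V' = "[:8, 6, 5, 4:]"
  and U'' = "[:10, 0, 8, 10:]"
  and V'' = "[:8, 6, 5, 4:]"
  and y = 0
  and u = special_y
  and v = special_x
  and h = preimage2
  and s = "\<lambda>i. [[:8, 3, 0, 6:], [:4, 8, 5, 6:], [:6, 10, 4, 6:], [:12, 2, 2, 6:], [:10, 5, 3, 6:], [:1, 7, 5, 6:], [:7, 8, 6:], [:1, 0, 4, 6:]] ! i"
  and t = "\<lambda>i. [[:1, 10, 3:], [:7, 0, 12:], [:3, 2, 11:], [:4, 11:], [:8, 9, 4:], [:2, 1, 2:], [:10, 1:], [:6, 2, 7:]] ! i"
  and M = "\<lambda>i. [[:1, 2, 3, 6:], [:1, 8, 3, 12:], [:8, 11, 12, 0:], [:5, 12, 12, 12:]] ! i"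
  and Q = "\<lambda>i. [[:0, 4, 6, 12, 10, 9, 9, 11, 4:],
      [:9, 3, 7, 10, 8, 2, 0, 12, 7, 11:],
      [:11, 2, 7, 6, 12, 6, 5, 3, 11, 0, 1:],
      [:8, 6, 12, 3, 1, 9, 10, 9, 3, 1, 8, 6:]] ! i"
  and W = "\<lambda>i j. [[9, 8, 4, 7], [8, 11, 3, 0], [5, 7, 12, 6], [7, 11, 8, 2]] ! i ! j"
  and G = curve2
  and i1 = 4
  and i2 = 3
  and K1 = "[:2, 2, 5:]"
  and K2 = "[:0, 1:]"
  by unfold_locales (simp_all add: certificate_simps special_x_def special_y_def curve2_def preimage2_def)

lemma curve2_invariants:
  assumes p: "int CHAR('a::idom) = 13"
  shows "degX (reduce2 curve2 :: 'a poly poly) = 4" "degY (reduce2 curve2 :: 'a poly poly) = 5"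
    "degT (reduce2 curve2 :: 'a poly poly) = 7"
    "i < 8 \<Longrightarrow> mult2 (of_int (special_y i)) (of_int (special_x i)) (reduce2 curve2 :: 'a poly poly) = (if i = 6 then 3 else 2)"
proof -
  have d: "degX curve2 = 4" by (simp add: curve2_def)
  have "\<forall>i\<le>4. degree (coeff curve2 i) \<le> 5" "\<forall>i\<le>4. degree (coeff curve2 i) \<le> 7 - i"
    by (simp_all add: certificate_simps curve2_def)
  then have a: "degX curve2 = 4" "\<forall>i\<le>degX curve2. degree (coeff curve2 i) \<le> 5"
     "\<forall>i\<le>degX curve2. degree (coeff curve2 i) \<le> 7 - i"
    by (simp_all only: d)
  have "\<not> 13 dvd coeff (coeff curve2 (degX curve2)) 3" "\<not> 13 dvd coeff (coeff curve2 2) 5" "\<not> 13 dvd coeff (coeff curve2 2) (7 - 2)"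
    by (simp_all add: certificate_simps curve2_def)
  then show "degX (reduce2 curve2 :: 'a poly poly) = 4" "degY (reduce2 curve2 :: 'a poly poly) = 5" "degT (reduce2 curve2 :: 'a poly poly) = 7"
    using degX_reduce2[where ?'a = 'a, of curve2 3] degY_reduce2[where ?'a = 'a, of curve2 5 2] degT_reduce2[where ?'a = 'a, of curve2 7 2] a p
    by simp_all
  have m: "\<forall>i<8. \<forall>r<(if i = 6 then 3 else 2). \<forall>s<(if i = 6 then 3 else 2) - r. 13 dvd hasse2 4 5 curve2 (special_y i) (special_x i) r s"
    by (simp only: all_less_numerals(1), intro conjI; simp add: certificate_simps special_x_def special_y_def)
      (simp_all add: certificate_simps hasse2_def curve2_def)
  have m': "\<forall>i<8. \<exists>r\<le>(if i = 6 then 3 else 2). \<not> 13 dvd hasse2 4 5 curve2 (special_y i) (special_x i) r ((if i = 6 then 3 else 2) - r)"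
    by (simp only: all_less_numerals(1), intro conjI; simp add: certificate_simps special_x_def special_y_def)
      (simp_all add: certificate_simps hasse2_def curve2_def)
  show "mult2 (of_int (special_y i)) (of_int (special_x i)) (reduce2 curve2 :: 'a poly poly) = (if i = 6 then 3 else 2)" if "i < 8"
    using m[rule_format, OF that] m'[rule_format, OF that] a by (intro mult2_reduce2[where a = 4 and b = 5]) (simp_all add: p)
qed

text \<open>
  The inequality says that \<open>N \<cdot> f\<close> is nonnegative for \<open>N = (9, 9; 5, 5, 4\<^sup>7)\<close>.  The multiplicity of \<open>f\<close> at
  \<open>(\<infinity>, \<infinity>)\<close>, which enters \<open>N \<cdot> f\<close> with the coefficient 4, is \<open>degX f + degY f - degT f\<close>.
\<close>

theorem nef_class_nonneg:
  fixes f :: "'a::field_gcd poly poly"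
  assumes p: "int CHAR('a) = 13" and f: "f \<noteq> 0"
  shows "4 * (\<Sum>i<8. int (mult2 (of_int (special_x i)) (of_int (special_y i)) f))
      + int (mult2 (of_int (special_x 5)) (of_int (special_y 5)) f)
      + int (mult2 (of_int (special_x 6)) (of_int (special_y 6)) f)
    \<le> 5 * (int (degX f) + int (degY f)) + 4 * int (degT f)"
proof -
  define m1 m2 :: "nat \<Rightarrow> nat" where "m1 i = (if i = 5 then 3 else 2)" and "m2 i = (if i = 6 then 3 else 2)" for i
  let ?x = "\<lambda>i. of_int (special_x i) :: 'a" and ?y = "\<lambda>i. of_int (special_y i) :: 'a"
  define N1 N2 :: "'a poly poly \<Rightarrow> int"
    where "N1 = curve_class_pairing 5 4 2 m1 {..<8} ?x ?y"
      and "N2 f = curve_class_pairing 5 4 2 m2 {..<8} ?y ?x (swap2 f)" for f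
  let ?G1 = "reduce2 curve1 :: 'a poly poly" and ?G2 = "swap2 (reduce2 curve2) :: 'a poly poly"
  have sum8: "sum g {..<8} = g 0 + g 1 + g 2 + g 3 + g 4 + g 5 + g 6 + g 7" for g :: "nat \<Rightarrow> int"
    by (simp add: eval_nat_numeral lessThan_Suc add_ac)
  have N2: "N2 f = int (5 * degY f) + int (4 * degX f) - 2 * (int (degY f) + int (degX f) - int (degT f))
      - (\<Sum>i<8. int (m2 i * mult2 (?x i) (?y i) f))" if "f \<noteq> 0" for f
    using that by (simp add: N2_def curve_class_pairing_def swap2_swap2 degT_swap2 mult2_swap2)
  note inv1 = curve1_invariants[where ?'a = 'a, OF p] and inv2 = curve2_invariants[where ?'a = 'a, OF p]
  have inv2': "degX ?G2 = 5" "degY ?G2 = 4" "degT ?G2 = 7" "i < 8 \<Longrightarrow> mult2 (?x i) (?y i) ?G2 = m2 i" for i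
  proof -
    have "(reduce2 curve2 :: 'a poly poly) \<noteq> 0" using inv2(1) by auto
    then show "degX ?G2 = 5" "degY ?G2 = 4" "degT ?G2 = 7" "i < 8 \<Longrightarrow> mult2 (?x i) (?y i) ?G2 = m2 i" for i
      using inv2 by (simp_all add: swap2_swap2 degT_swap2 m2_def mult2_swap2)
  qed
  have G0: "?G1 \<noteq> 0" "?G2 \<noteq> 0" using inv1(1) inv2'(1) by auto
  have v: "N1 ?G1 = -1" "N2 ?G1 = 1" "N1 ?G2 = 1" "N2 ?G2 = -1"
    using inv1 inv2' by (simp_all add: N2[OF G0(1)] N2[OF G0(2)] N1_def curve_class_pairing_def sum8 m1_def m2_def)
  have "0 \<le> N1 f + N2 f"
  proof (rule nef_sum_of_two_curves[where ?G1.0 = ?G1 and ?G2.0 = ?G2, OF _ _ _ _ _ _ _ _ f])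
    show "N1 (f * g) = N1 f + N1 g" if "f \<noteq> 0" "g \<noteq> 0" for f g
      unfolding N1_def using that by (rule curve_class_pairing_mult)
    show "N2 (f * g) = N2 f + N2 g" if "f \<noteq> 0" "g \<noteq> 0" for f g
      unfolding N2_def swap2_mult using that by (intro curve_class_pairing_mult) (simp_all add: swap2_eq_0_iff)
    have h: "curve_class_pairing 5 4 (degree ([:7, 4, 1:] :: int poly)) (\<lambda>i. degree (preimage1 i)) {..<8} ?x ?y = N1"
      "curve_class_pairing 5 4 (degree ([:8, 8, 1:] :: int poly)) (\<lambda>i. degree (preimage2 i)) {..<8} ?y ?x = curve_class_pairing 5 4 2 m2 {..<8} ?y ?x"
      unfolding N1_def curve_class_pairing_def[abs_def] by (simp_all add: sum8 m1_def m2_def preimage1_def preimage2_def)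
    show "?G1 dvd f" if "f \<noteq> 0" "N1 f < 0" for f
      using curve1.reduction_dvd[where ?'a = 'a, OF p, unfolded h] that v by simp
    show "?G2 dvd f" if "f \<noteq> 0" "N2 f < 0" for f
    proof -
      have "reduce2 curve2 dvd swap2 f"
        using curve2.reduction_dvd[where ?'a = 'a and f = "swap2 f", OF p, unfolded h] that v by (simp add: N2_def swap2_swap2 swap2_eq_0_iff)
      then show ?thesis by (metis dvd_def swap2_mult swap2_swap2)
    qed
  qed (use v inv1 inv2' in auto)
  then show ?thesis
    unfolding N2[OF f] N1_def curve_class_pairing_def by (simp add: sum8 m1_def m2_def)
qed

section \<open>Nonvanishing minors\<close>

text \<open>
  Rows are added one at a time.  By expansion along the last row, the determinants obtained by
  bordering a nonzero minor with the possible next rows are the values of the rows at one fixed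
  vector.  One entry of this vector is the given minor; hence it is nonzero, and since the kernel is
  trivial some row takes a nonzero value on it.
\<close>

lemma nonzero_minor_exists:
  fixes M :: "'r \<Rightarrow> nat \<Rightarrow> 'a::field"
  assumes inj: "\<And>x. (\<And>r. r \<in> R \<Longrightarrow> (\<Sum>j<k. M r j * x j) = 0) \<Longrightarrow> (\<And>j. j < k \<Longrightarrow> x j = 0)"
    and "l \<le> k"
  shows "\<exists>\<rho>. (\<forall>i<l. \<rho> i \<in> R) \<and> det (mat l l (\<lambda>(i, j). M (\<rho> i) j)) \<noteq> 0"
  using \<open>l \<le> k\<close>
proof (induction l)
  case 0
  show ?case by (rule exI[of _ undefined]) (simp add: det_dim_zero)
next
  case (Suc l)
  then obtain \<rho> where \<rho>: "\<And>i. i < l \<Longrightarrow> \<rho> i \<in> R" "det (mat l l (\<lambda>(i, j). M (\<rho> i) j)) \<noteq> 0" by auto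
  define A where "A r = mat (Suc l) (Suc l) (\<lambda>(i, j). M ((\<rho>(l := r)) i) j)" for r
  define x where "x j = (if j < Suc l then cofactor (A undefined) l j else 0)" for j
  have cof: "cofactor (A r) l j = x j" if "j < Suc l" for r j
  proof -
    have "mat_delete (A r) l j = mat_delete (A undefined) l j"
      by (rule eq_matI) (auto simp: A_def mat_delete_def)
    then show ?thesis using that by (simp add: x_def cofactor_def)
  qed
  have "det (A r) = (\<Sum>j<k. M r j * x j)" for r
  proof -
    have "det (A r) = (\<Sum>j<Suc l. A r $$ (l, j) * cofactor (A r) l j)"
      by (rule laplace_expansion_row) (auto simp: A_def)
    also have "\<dots> = (\<Sum>j<Suc l. M r j * x j)"
      by (intro sum.cong refl) (simp add: cof, simp add: A_def)
    also have "\<dots> = (\<Sum>j<k. M r j * x j)"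
      using Suc.prems by (intro sum.mono_neutral_left) (auto simp: x_def)
    finally show ?thesis .
  qed
  moreover have "x l \<noteq> 0"
  proof -
    have "mat_delete (A undefined) l l = mat l l (\<lambda>(i, j). M (\<rho> i) j)"
      by (rule eq_matI) (auto simp: A_def mat_delete_def)
    then show ?thesis using \<rho>(2) by (simp add: x_def cofactor_def)
  qed
  ultimately obtain r where "r \<in> R" "det (A r) \<noteq> 0"
    using inj[of x l] Suc.prems by force
  then show ?case
    using \<rho>(1) unfolding A_def by (intro exI[of _ "\<rho>(l := r)"]) (auto simp: less_Suc_eq)
qed

text \<open>
  Triviality of the kernel over one field, of any characteristic, yields a minor that is a nonzero
  integer and therefore survives in the complex numbers.
\<close>

lemma nonzero_integral_minor_exists:
  fixes M :: "'r \<Rightarrow> nat \<Rightarrow> int"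
  assumes inj: "\<And>x :: nat \<Rightarrow> 'a::field. (\<And>r. r \<in> R \<Longrightarrow> (\<Sum>j<k. of_int (M r j) * x j) = 0) \<Longrightarrow> (\<And>j. j < k \<Longrightarrow> x j = 0)"
  shows "\<exists>\<rho>. (\<forall>i<k. \<rho> i \<in> R) \<and> det (mat k k (\<lambda>(i, j). M (\<rho> i) j)) \<noteq> 0"
proof -
  obtain \<rho> where \<rho>: "\<forall>i<k. \<rho> i \<in> R" "det (mat k k (\<lambda>(i, j). of_int (M (\<rho> i) j) :: 'a)) \<noteq> 0"
    using nonzero_minor_exists[where M = "\<lambda>r j. of_int (M r j) :: 'a" and R = R and k = k and l = k] inj by auto
  have "mat k k (\<lambda>(i, j). of_int (M (\<rho> i) j) :: 'a) = map_mat of_int (mat k k (\<lambda>(i, j). M (\<rho> i) j))"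
    by (rule eq_matI) auto
  then have "det (mat k k (\<lambda>(i, j). of_int (M (\<rho> i) j) :: 'a)) = of_int (det (mat k k (\<lambda>(i, j). M (\<rho> i) j)))"
    by (simp add: of_int_hom.hom_det)
  with \<rho> show ?thesis by (intro exI[of _ \<rho>]) auto
qed

lemma det_of_rows_zero_if_kernel:
  fixes M :: "nat \<Rightarrow> nat \<Rightarrow> 'a::field"
  shows "det (mat k k (\<lambda>(i, j). M i j)) = 0 \<longleftrightarrow>
    (\<exists>x. (\<exists>j<k. x j \<noteq> 0) \<and> (\<forall>i<k. (\<Sum>j<k. M i j * x j) = 0))"
proof -
  let ?A = "mat k k (\<lambda>(i, j). M i j)"
  have mv: "?A *\<^sub>v v = 0\<^sub>v k \<longleftrightarrow> (\<forall>i<k. (\<Sum>j<k. M i j * vec_index v j) = 0)" if "v \<in> carrier_vec k" for v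
    using that by (auto simp: Matrix.vec_eq_iff scalar_prod_def atLeast0LessThan)
  have "det ?A = 0 \<longleftrightarrow> (\<exists>v. v \<in> carrier_vec k \<and> v \<noteq> 0\<^sub>v k \<and> ?A *\<^sub>v v = 0\<^sub>v k)"
    by (rule det_0_iff_vec_prod_zero) simp
  also have "\<dots> \<longleftrightarrow> (\<exists>x. (\<exists>j<k. x j \<noteq> 0) \<and> (\<forall>i<k. (\<Sum>j<k. M i j * x j) = 0))"
  proof
    assume "\<exists>v. v \<in> carrier_vec k \<and> v \<noteq> 0\<^sub>v k \<and> ?A *\<^sub>v v = 0\<^sub>v k"
    then obtain v where "v \<in> carrier_vec k" "v \<noteq> 0\<^sub>v k" "?A *\<^sub>v v = 0\<^sub>v k" by blast
    then show "\<exists>x. (\<exists>j<k. x j \<noteq> 0) \<and> (\<forall>i<k. (\<Sum>j<k. M i j * x j) = 0)"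
      using mv[of v] by (intro exI[of _ "\<lambda>j. vec_index v j"]) (auto simp: Matrix.vec_eq_iff)
  next
    assume "\<exists>x. (\<exists>j<k. x j \<noteq> 0) \<and> (\<forall>i<k. (\<Sum>j<k. M i j * x j) = 0)"
    then obtain x where "\<exists>j<k. x j \<noteq> 0" "\<forall>i<k. (\<Sum>j<k. M i j * x j) = 0" by blast
    then show "\<exists>v. v \<in> carrier_vec k \<and> v \<noteq> 0\<^sub>v k \<and> ?A *\<^sub>v v = 0\<^sub>v k"
      using mv[of "Matrix.vec k x"] by (intro exI[of _ "Matrix.vec k x"]) (auto simp: Matrix.vec_eq_iff)
  qed
  finally show ?thesis .
qed

section \<open>Multiplicity as a system of linear conditions\<close>

text \<open>
  The Hasse derivative of order \<open>\<beta>\<close> of the monomial with exponent \<open>\<tau>\<close> at \<open>v\<close>, that is, the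
  coefficient of \<open>X\<^sup>\<beta>\<close> in \<open>(v + X)\<^sup>\<tau>\<close>.
\<close>

definition hasse_monom :: "('x::finite \<Rightarrow> nat) \<Rightarrow> ('x \<Rightarrow> nat) \<Rightarrow> ('x \<Rightarrow> 'a::comm_ring_1) \<Rightarrow> 'a"
  where "hasse_monom \<beta> \<tau> v = (\<Prod>j\<in>UNIV. of_nat (\<tau> j choose \<beta> j) * v j ^ (\<tau> j - \<beta> j))"

lemma lookup_sum_single_UNIV:
  "Poly_Mapping.lookup (\<Sum>j\<in>UNIV. Poly_Mapping.single j (\<kappa> j)) (q :: 'x::finite) = (\<kappa> q :: nat)"
  by (simp add: lookup_sum lookup_single when_def)

lemma prod_single:
  "finite J \<Longrightarrow> (\<Prod>j\<in>J. Poly_Mapping.single (e j) (a j :: 'a::comm_semiring_1)) =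
    Poly_Mapping.single (\<Sum>j\<in>J. e j :: 'b::comm_monoid_add) (\<Prod>j\<in>J. a j)"
  by (induction J rule: finite_induct) (simp_all add: mult_single)

lemma lookup_prod_UNIV:
  fixes a :: "'x::finite \<Rightarrow> nat \<Rightarrow> 'a::comm_ring_1"
  assumes a: "\<And>j k. n j < k \<Longrightarrow> a j k = 0"
  shows "Poly_Mapping.lookup (Const c * (\<Prod>j\<in>UNIV. \<Sum>k\<le>n j. Poly_Mapping.single (Poly_Mapping.single j k) (a j k))) s
    = c * (\<Prod>j\<in>UNIV. a j (Poly_Mapping.lookup s j))"
proof -
  let ?K = "PiE UNIV (\<lambda>j. {..n j})"
  have fin: "finite ?K" by (intro finite_PiE) auto
  have "Const c * (\<Prod>j\<in>UNIV. \<Sum>k\<le>n j. Poly_Mapping.single (Poly_Mapping.single j k) (a j k))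
    = (\<Sum>\<kappa>\<in>?K. Poly_Mapping.single (\<Sum>j\<in>UNIV. Poly_Mapping.single j (\<kappa> j)) (c * (\<Prod>j\<in>UNIV. a j (\<kappa> j))))"
    by (simp add: prod_sum_PiE prod_single sum_distrib_left Const_def mult_single)
  also have "Poly_Mapping.lookup \<dots> s = (\<Sum>\<kappa>\<in>?K. if \<kappa> = Poly_Mapping.lookup s then c * (\<Prod>j\<in>UNIV. a j (\<kappa> j)) else 0)"
    unfolding lookup_sum
  proof (intro sum.cong refl)
    fix \<kappa>
    have "(\<Sum>j\<in>UNIV. Poly_Mapping.single j (\<kappa> j)) = s \<longleftrightarrow> \<kappa> = Poly_Mapping.lookup s"
      by (auto simp: poly_mapping_eq_iff lookup_sum_single_UNIV fun_eq_iff)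
    then show "Poly_Mapping.lookup (Poly_Mapping.single (\<Sum>j\<in>UNIV. Poly_Mapping.single j (\<kappa> j)) (c * (\<Prod>j\<in>UNIV. a j (\<kappa> j)))) s
       = (if \<kappa> = Poly_Mapping.lookup s then c * (\<Prod>j\<in>UNIV. a j (\<kappa> j)) else 0)"
      by (simp add: lookup_single when_def)
  qed
  also have "\<dots> = c * (\<Prod>j\<in>UNIV. a j (Poly_Mapping.lookup s j))"
  proof (cases "Poly_Mapping.lookup s \<in> ?K")
    case False
    then obtain j where "n j < Poly_Mapping.lookup s j" by (auto simp: PiE_def Pi_def not_le)
    then have "(\<Prod>j\<in>UNIV. a j (Poly_Mapping.lookup s j)) = 0" using a by (intro prod_zero) auto
    with False show ?thesis by (simp add: fin)
  qed (simp add: fin)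
  finally show ?thesis .
qed

lemma power_affine_coordinate:
  "(Var j + Const c) ^ n = (\<Sum>k\<le>n. Poly_Mapping.single (Poly_Mapping.single j k) (of_nat (n choose k) * c ^ (n - k)) :: ('x, 'a::comm_ring_1) mpoly)"
proof -
  have V: "(Var j :: ('x, 'a) mpoly) ^ k = Poly_Mapping.single (Poly_Mapping.single j k) 1" for k
    by (induction k) (simp_all add: Var_def mult_single flip: single_add)
  have C: "(Const c :: ('x, 'a) mpoly) ^ k = Poly_Mapping.single 0 (c ^ k)" for k
    by (induction k) (simp_all add: Const_def mult_single)
  show ?thesis
    unfolding binomial_ring V C by (simp add: mult_single flip: single_of_nat)
qed

lemma lookup_local_equation:
  "Poly_Mapping.lookup (local_equation i v F) s =
    (\<Sum>t\<in>Poly_Mapping.keys F. Poly_Mapping.lookup F t *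
      (\<Prod>j\<in>UNIV. if j = i then (if Poly_Mapping.lookup s i = 0 then 1 else 0)
        else of_nat (Poly_Mapping.lookup t j choose Poly_Mapping.lookup s j) *
          (v $ j / v $ i) ^ (Poly_Mapping.lookup t j - Poly_Mapping.lookup s j)))"
proof -
  define g where "g j = (if j = i then 1 else Var j + Const (v $ j / v $ i) :: (3, complex) mpoly)" for j
  define a where "a n j k = (if j = i then (if k = 0 then 1 else 0)
    else of_nat (n choose k) * (v $ j / v $ i) ^ (n - k) :: complex)" for n j k
  have g: "g j ^ n = (\<Sum>k\<le>n. Poly_Mapping.single (Poly_Mapping.single j k) (a n j k))" for j n
  proof (cases "j = i")
    case True
    have "(\<Sum>k\<le>n. Poly_Mapping.single (Poly_Mapping.single j k) (a n j k)) =
      (\<Sum>k\<in>{0}. Poly_Mapping.single (Poly_Mapping.single j k) (a n j k) :: (3, complex) mpoly)"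
      using True by (intro sum.mono_neutral_right) (auto simp: a_def)
    then show ?thesis using True by (simp add: a_def g_def)
  next
    case False
    then show ?thesis by (simp add: a_def g_def power_affine_coordinate)
  qed
  have summand: "Poly_Mapping.lookup (Const c * (\<Prod>j\<in>Poly_Mapping.keys t. g j ^ Poly_Mapping.lookup t j)) s
    = c * (\<Prod>j\<in>UNIV. a (Poly_Mapping.lookup t j) j (Poly_Mapping.lookup s j))" for c t
  proof -
    have "(\<Prod>j\<in>Poly_Mapping.keys t. g j ^ Poly_Mapping.lookup t j) = (\<Prod>j\<in>UNIV. g j ^ Poly_Mapping.lookup t j)"
      by (intro prod.mono_neutral_left) (auto simp: in_keys_iff)
    also have "\<dots> = (\<Prod>j\<in>UNIV. \<Sum>k\<le>Poly_Mapping.lookup t j. Poly_Mapping.single (Poly_Mapping.single j k) (a (Poly_Mapping.lookup t j) j k))"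
      by (simp only: g)
    also have "Poly_Mapping.lookup (Const c * \<dots>) s = c * (\<Prod>j\<in>UNIV. a (Poly_Mapping.lookup t j) j (Poly_Mapping.lookup s j))"
      by (rule lookup_prod_UNIV) (auto simp: a_def binomial_eq_0)
    finally show ?thesis .
  qed
  have "local_equation i v F = (\<Sum>t\<in>Poly_Mapping.keys F. Const (Poly_Mapping.lookup F t) * (\<Prod>j\<in>Poly_Mapping.keys t. g j ^ Poly_Mapping.lookup t j))"
    by (simp add: local_equation_def mpoly_eval_def g_def)
  then show ?thesis
    by (simp only: lookup_sum summand) (simp add: a_def cong: if_cong)
qed

definition multi_indices :: "nat \<Rightarrow> ('x::finite \<Rightarrow> nat) set"
  where "multi_indices d = {\<tau>. (\<Sum>j\<in>UNIV. \<tau> j) = d}"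

lemma finite_multi_indices: "finite (multi_indices d :: ('x::finite \<Rightarrow> nat) set)"
proof (rule finite_subset)
  show "multi_indices d \<subseteq> PiE (UNIV :: 'x set) (\<lambda>_. {..d})"
    by (auto simp: multi_indices_def intro!: member_le_sum)
qed (intro finite_PiE, auto)

lemma lookup_Abs_finite: "Poly_Mapping.lookup (Abs_poly_mapping (f :: 'x::finite \<Rightarrow> nat)) = f"
  by (simp add: Abs_poly_mapping_inverse)

lemma Abs_lookup: "Abs_poly_mapping (Poly_Mapping.lookup t) = t"
  by (simp add: lookup_inverse)

lemma sum_keys_homogeneous:
  assumes "homogeneous d (F :: ('x::finite, 'a::comm_ring_1) mpoly)"
  shows "(\<Sum>t\<in>Poly_Mapping.keys F. Poly_Mapping.lookup F t * g (Poly_Mapping.lookup t)) =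
    (\<Sum>\<tau>\<in>multi_indices d. Poly_Mapping.lookup F (Abs_poly_mapping \<tau>) * g \<tau>)"
proof -
  have "(\<Sum>\<tau>\<in>multi_indices d. Poly_Mapping.lookup F (Abs_poly_mapping \<tau>) * g \<tau>)
    = (\<Sum>t\<in>Abs_poly_mapping ` multi_indices d. Poly_Mapping.lookup F t * g (Poly_Mapping.lookup t))"
    by (subst sum.reindex) (auto intro!: inj_on_inverseI[where g = Poly_Mapping.lookup] simp: lookup_Abs_finite)
  also have "\<dots> = (\<Sum>t\<in>Poly_Mapping.keys F. Poly_Mapping.lookup F t * g (Poly_Mapping.lookup t))"
  proof (intro sum.mono_neutral_right)
    show "Poly_Mapping.keys F \<subseteq> Abs_poly_mapping ` multi_indices d"
    proof
      fix t assume t: "t \<in> Poly_Mapping.keys F"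
      have "(\<Sum>j\<in>UNIV. Poly_Mapping.lookup t j) = monom_deg t"
        unfolding monom_deg_def by (intro sum.mono_neutral_right) (auto simp: in_keys_iff)
      then have "Poly_Mapping.lookup t \<in> multi_indices d"
        using assms t by (simp add: multi_indices_def homogeneous_def)
      then show "t \<in> Abs_poly_mapping ` multi_indices d" by (metis Abs_lookup imageI)
    qed
  qed (auto simp: finite_multi_indices in_keys_iff)
  finally show ?thesis by simp
qed

text \<open>
  For a derivative that does not involve the coordinate \<open>i\<close>, dehomogenising by the coordinate \<open>i\<close>
  only changes the value by a power of this coordinate, which is the same for all monomials of
  degree \<open>d\<close>.
\<close>

lemma hasse_monom_chart:
  assumes \<tau>: "\<tau> \<in> multi_indices d" and \<beta>: "\<beta> i = 0" and v: "v i \<noteq> (0 :: 'a::field)"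
  shows "hasse_monom \<beta> \<tau> v = v i ^ (d - (\<Sum>j\<in>UNIV. \<beta> j)) *
    (\<Prod>j\<in>UNIV. if j = i then 1 else of_nat (\<tau> j choose \<beta> j) * (v j / v i) ^ (\<tau> j - \<beta> j))"
proof (cases "\<forall>j. \<beta> j \<le> \<tau> j")
  case False
  then obtain j where j: "\<tau> j < \<beta> j" by (auto simp: not_le)
  then have "j \<noteq> i" using \<beta> by auto
  then have "(\<Prod>j\<in>UNIV. if j = i then 1 else of_nat (\<tau> j choose \<beta> j) * (v j / v i) ^ (\<tau> j - \<beta> j)) = 0"
    using j by (intro prod_zero) (auto intro!: exI[of _ j] simp: binomial_eq_0)
  moreover have "hasse_monom \<beta> \<tau> v = 0"
    unfolding hasse_monom_def using j by (intro prod_zero) (auto intro!: exI[of _ j] simp: binomial_eq_0)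
  ultimately show ?thesis by simp
next
  case True
  have "(\<Sum>j\<in>UNIV. \<tau> j - \<beta> j) = d - (\<Sum>j\<in>UNIV. \<beta> j)"
    using True \<tau> sum_subtractf_nat[of UNIV \<beta> \<tau>] by (simp add: multi_indices_def)
  then have "v i ^ (d - (\<Sum>j\<in>UNIV. \<beta> j)) = (\<Prod>j\<in>UNIV. v i ^ (\<tau> j - \<beta> j))"
    by (metis power_sum)
  then have "v i ^ (d - (\<Sum>j\<in>UNIV. \<beta> j)) *
    (\<Prod>j\<in>UNIV. if j = i then 1 else of_nat (\<tau> j choose \<beta> j) * (v j / v i) ^ (\<tau> j - \<beta> j))
    = (\<Prod>j\<in>UNIV. v i ^ (\<tau> j - \<beta> j) * (if j = i then 1 else of_nat (\<tau> j choose \<beta> j) * (v j / v i) ^ (\<tau> j - \<beta> j)))"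
    by (simp only: prod.distrib)
  also have "\<dots> = hasse_monom \<beta> \<tau> v"
    unfolding hasse_monom_def
  proof (intro prod.cong refl)
    fix j
    show "v i ^ (\<tau> j - \<beta> j) * (if j = i then 1 else of_nat (\<tau> j choose \<beta> j) * (v j / v i) ^ (\<tau> j - \<beta> j))
      = of_nat (\<tau> j choose \<beta> j) * v j ^ (\<tau> j - \<beta> j)"
      using v by (cases "j = i") (simp_all add: \<beta> power_divide)
  qed
  finally show ?thesis by simp
qed

text \<open>
  The coefficients of low order of the local equation vanish.  By homogeneity these are, up to powers
  of the \<open>i\<close>-th coordinate, Hasse derivatives of \<open>F\<close> at the homogeneous coordinates of the point; in
  this form the conditions are polynomial in these coordinates.
\<close>

lemma hasse_conditions_if_multiplicity:
  assumes F: "homogeneous d F" and m: "enat m \<le> multiplicity F P"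
    and v: "rep_proj_plane P $ i \<noteq> 0" and \<beta>: "\<beta> i = 0" "(\<Sum>j\<in>UNIV. \<beta> j) < m"
  shows "(\<Sum>\<tau>\<in>multi_indices d. Poly_Mapping.lookup F (Abs_poly_mapping \<tau>) * hasse_monom \<beta> \<tau> (($) (rep_proj_plane P))) = 0"
proof -
  let ?v = "rep_proj_plane P" and ?s = "Abs_poly_mapping \<beta>"
  have "monom_deg ?s = (\<Sum>j\<in>UNIV. \<beta> j)"
    unfolding monom_deg_def by (intro sum.mono_neutral_cong_left) (auto simp: in_keys_iff lookup_Abs_finite)
  moreover have "multiplicity F P \<le> order_at_origin (local_equation i ?v F)"
    unfolding multiplicity.rep_eq using v by (intro INF_lower) auto
  then have "enat m \<le> order_at_origin (local_equation i ?v F)" using m by (rule order_trans[rotated])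
  then have "?s \<in> Poly_Mapping.keys (local_equation i ?v F) \<Longrightarrow> m \<le> monom_deg ?s"
    unfolding order_at_origin_def by (auto simp: le_INF_iff)
  ultimately have "Poly_Mapping.lookup (local_equation i ?v F) ?s = 0"
    using \<beta>(2) by (auto simp: in_keys_iff)
  then have "(\<Sum>\<tau>\<in>multi_indices d. Poly_Mapping.lookup F (Abs_poly_mapping \<tau>) *
      (\<Prod>j\<in>UNIV. if j = i then 1 else of_nat (\<tau> j choose \<beta> j) * (?v $ j / ?v $ i) ^ (\<tau> j - \<beta> j))) = 0"
    unfolding lookup_local_equation lookup_Abs_finite
    by (subst (asm) sum_keys_homogeneous[OF F]) (simp add: \<beta>(1) cong: if_cong)
  then have "?v $ i ^ (d - (\<Sum>j\<in>UNIV. \<beta> j)) * (\<Sum>\<tau>\<in>multi_indices d. Poly_Mapping.lookup F (Abs_poly_mapping \<tau>) *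
      (\<Prod>j\<in>UNIV. if j = i then 1 else of_nat (\<tau> j choose \<beta> j) * (?v $ j / ?v $ i) ^ (\<tau> j - \<beta> j))) = 0"
    by simp
  then show ?thesis
    unfolding sum_distrib_left using hasse_monom_chart[where v = "($) ?v" and i = i and \<beta> = \<beta>, OF _ \<beta>(1) v]
    by (simp add: mult_ac cong: sum.cong_simp)
qed

section \<open>The open set defined by a minor\<close>

lemma mpoly_eval_eq_sum:
  fixes F :: "('x, 'a::comm_ring_1) mpoly"
  assumes "finite S" "Poly_Mapping.keys F \<subseteq> S"
  shows "mpoly_eval id x F = (\<Sum>t\<in>S. Poly_Mapping.lookup F t * (\<Prod>j\<in>Poly_Mapping.keys t. x j ^ Poly_Mapping.lookup t j))"
  unfolding mpoly_eval_def using assms by (intro sum.mono_neutral_cong_left) (auto simp: in_keys_iff)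

lemma keys_sum_subset: "Poly_Mapping.keys (\<Sum>a\<in>A. g a) \<subseteq> (\<Union>a\<in>A. Poly_Mapping.keys (g a))"
proof
  fix t assume "t \<in> Poly_Mapping.keys (\<Sum>a\<in>A. g a)"
  then have "(\<Sum>a\<in>A. Poly_Mapping.lookup (g a) t) \<noteq> 0" by (simp add: in_keys_iff lookup_sum)
  then obtain a where "a \<in> A" "Poly_Mapping.lookup (g a) t \<noteq> 0" by (rule sum.not_neutral_contains_not_neutral)
  then show "t \<in> (\<Union>a\<in>A. Poly_Mapping.keys (g a))" by (auto simp: in_keys_iff)
qed

lemma mpoly_eval_sum_single:
  fixes c :: "'b \<Rightarrow> 'a::comm_ring_1"
  assumes "finite A"
  shows "mpoly_eval id x (\<Sum>a\<in>A. Poly_Mapping.single (e a) (c a)) =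
    (\<Sum>a\<in>A. c a * (\<Prod>j\<in>Poly_Mapping.keys (e a). x j ^ Poly_Mapping.lookup (e a) j))"
proof -
  let ?F = "\<Sum>a\<in>A. Poly_Mapping.single (e a) (c a)"
  let ?p = "\<lambda>t. \<Prod>j\<in>Poly_Mapping.keys t. x j ^ Poly_Mapping.lookup t j"
  have "Poly_Mapping.keys ?F \<subseteq> e ` A"
    using keys_sum_subset[of "\<lambda>a. Poly_Mapping.single (e a) (c a)" A] by (auto split: if_splits)
  then have "mpoly_eval id x ?F = (\<Sum>t\<in>e ` A. Poly_Mapping.lookup ?F t * ?p t)"
    using assms by (intro mpoly_eval_eq_sum) auto
  also have "\<dots> = (\<Sum>t\<in>e ` A. \<Sum>a\<in>A. if e a = t then c a * ?p t else 0)"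
    by (simp add: lookup_sum lookup_single when_def sum_distrib_right if_distrib[of "\<lambda>z. z * _"] cong: if_cong)
  also have "\<dots> = (\<Sum>a\<in>A. c a * ?p (e a))"
    using assms by (subst sum.swap) (simp add: sum.delta)
  finally show ?thesis .
qed

lemma monomial_eval_sum:
  fixes x :: "'x \<Rightarrow> 'a::comm_ring_1"
  defines "ev \<equiv> \<lambda>t. \<Prod>j\<in>Poly_Mapping.keys t. x j ^ Poly_Mapping.lookup t j"
  shows "ev (s + t) = ev s * ev t" "finite I \<Longrightarrow> ev (\<Sum>i\<in>I. g i) = (\<Prod>i\<in>I. ev (g i))" "ev (Poly_Mapping.single j n) = x j ^ n"
proof -
  have sup: "ev t = (\<Prod>j\<in>S. x j ^ Poly_Mapping.lookup t j)" if "finite S" "Poly_Mapping.keys t \<subseteq> S" for S t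
    unfolding ev_def using that by (intro prod.mono_neutral_left) (auto simp: in_keys_iff)
  show add: "ev (s + t) = ev s * ev t" for s t
    by (subst (1 2 3) sup[of "Poly_Mapping.keys s \<union> Poly_Mapping.keys t"])
      (use keys_add[of s t] in \<open>auto simp: lookup_add power_add prod.distrib\<close>)
  show "ev (Poly_Mapping.single j n) = x j ^ n" by (simp add: ev_def)
  show "finite I \<Longrightarrow> ev (\<Sum>i\<in>I. g i) = (\<Prod>i\<in>I. ev (g i))"
    by (induction I rule: finite_induct) (simp_all add: add, simp add: ev_def)
qed

text \<open>
  A minor of the matrix of conditions is multihomogeneous in the points, since the row of a condition
  of order \<open>\<beta>\<close> at a point has degree \<open>d - |\<beta>|\<close> in the coordinates of this point.  The factors
  \<open>Var (i, chart i)\<close> ensure that every point lies in the chart in which its conditions are written.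
\<close>

lemma zariski_open_minor:
  fixes pt :: "nat \<Rightarrow> nat" and \<beta> \<tau> :: "nat \<Rightarrow> 3 \<Rightarrow> nat" and chart :: "nat \<Rightarrow> 3"
  assumes pt: "\<And>l. l < k \<Longrightarrow> pt l < n" and \<tau>: "\<And>l. l < k \<Longrightarrow> \<tau> l \<in> multi_indices d"
  shows "zariski_open n {ps. length ps = n \<and> (\<forall>i<n. rep_proj_plane (ps ! i) $ chart i \<noteq> 0) \<and>
    det (mat k k (\<lambda>(l, c). hasse_monom (\<beta> l) (\<tau> c) (($) (rep_proj_plane (ps ! pt l))))) \<noteq> 0}"
proof -
  define P where "P = {\<pi>. \<pi> permutes {0..<k}}"
  define e where "e \<pi> = (\<Sum>l<k. \<Sum>j\<in>UNIV. Poly_Mapping.single (pt l, j) (\<tau> (\<pi> l) j - \<beta> l j)) + (\<Sum>i<n. Poly_Mapping.single (i, chart i) 1)" for \<pi>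
  define c where "c \<pi> = (signof \<pi> * (\<Prod>l<k. \<Prod>j\<in>UNIV. of_nat (\<tau> (\<pi> l) j choose \<beta> l j)) :: complex)" for \<pi>
  define f where "f = (\<Sum>\<pi>\<in>P. Poly_Mapping.single (e \<pi>) (c \<pi>))"
  have finP: "finite P" by (simp add: P_def finite_permutations)
  have eval: "mpoly_eval id x f = (\<Prod>i<n. x (i, chart i)) * det (mat k k (\<lambda>(l, c). hasse_monom (\<beta> l) (\<tau> c) (\<lambda>j. x (pt l, j))))" for x
  proof -
    have "c \<pi> * (\<Prod>j\<in>Poly_Mapping.keys (e \<pi>). x j ^ Poly_Mapping.lookup (e \<pi>) j)
      = (\<Prod>i<n. x (i, chart i)) * (signof \<pi> * (\<Prod>l<k. hasse_monom (\<beta> l) (\<tau> (\<pi> l)) (\<lambda>j. x (pt l, j))))" for \<pi>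
      unfolding e_def c_def hasse_monom_def monomial_eval_sum(1,3) monomial_eval_sum(2)[OF finite_lessThan]
        monomial_eval_sum(2)[OF finite_class.finite_UNIV] prod.distrib
      by (simp add: mult_ac)
    moreover have "(\<Prod>l<k. hasse_monom (\<beta> l) (\<tau> (\<pi> l)) (\<lambda>j. x (pt l, j)))
      = (\<Prod>l = 0..<k. mat k k (\<lambda>(l, c). hasse_monom (\<beta> l) (\<tau> c) (\<lambda>j. x (pt l, j))) $$ (l, \<pi> l))" if "\<pi> \<in> P" for \<pi>
    proof (intro prod.cong)
      fix l assume "l \<in> {0..<k}"
      then have "l < k" "\<pi> l < k" using permutes_in_image[of \<pi> "{0..<k}" l] that by (auto simp: P_def)
      then show "hasse_monom (\<beta> l) (\<tau> (\<pi> l)) (\<lambda>j. x (pt l, j)) =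
        mat k k (\<lambda>(l, c). hasse_monom (\<beta> l) (\<tau> c) (\<lambda>j. x (pt l, j))) $$ (l, \<pi> l)" by simp
    qed (simp add: atLeast0LessThan)
    ultimately show ?thesis
      unfolding f_def mpoly_eval_sum_single[OF finP] det_def by (simp add: P_def sum_distrib_left)
  qed
  \<comment> \<open>Terms with some \<open>\<beta> > \<tau>\<close> have wrong exponents because of truncated subtraction, but coefficient zero.\<close>
  have "multihomogeneous n f"
    unfolding multihomogeneous_def
  proof (intro exI ballI conjI allI impI)
    fix t assume "t \<in> Poly_Mapping.keys f"
    then obtain \<pi> where \<pi>: "\<pi> \<in> P" "t = e \<pi>" "c \<pi> \<noteq> 0"
      using keys_sum_subset[of "\<lambda>\<pi>. Poly_Mapping.single (e \<pi>) (c \<pi>)" P] by (auto simp: f_def split: if_splits)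
    have lk: "Poly_Mapping.lookup t (i, j) = (\<Sum>l<k. if pt l = i then \<tau> (\<pi> l) j - \<beta> l j else 0) + (if i < n \<and> chart i = j then 1 else 0)" for i j
    proof -
      have "(\<Sum>j'\<in>UNIV. Poly_Mapping.lookup (Poly_Mapping.single (pt l, j') (\<tau> (\<pi> l) j' - \<beta> l j')) (i, j)) = (if pt l = i then \<tau> (\<pi> l) j - \<beta> l j else 0)" for l
        by (simp add: lookup_single when_def)
      moreover have "(\<Sum>i'<n. Poly_Mapping.lookup (Poly_Mapping.single (i', chart i') 1) (i, j)) = (if i < n \<and> chart i = j then 1 else (0::nat))"
      proof -
        have "(\<Sum>i'<n. Poly_Mapping.lookup (Poly_Mapping.single (i', chart i') 1) (i, j)) = (\<Sum>i'<n. if i' = i then (if chart i = j then 1 else (0::nat)) else 0)"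
          by (intro sum.cong) (auto simp: lookup_single when_def)
        then show ?thesis by simp
      qed
      ultimately show ?thesis by (simp add: \<pi>(2) e_def lookup_add lookup_sum)
    qed
    show "Poly_Mapping.keys t \<subseteq> {..<n} \<times> UNIV"
    proof
      fix q assume "q \<in> Poly_Mapping.keys t"
      then have "Poly_Mapping.lookup t (fst q, snd q) \<noteq> 0" by (simp add: in_keys_iff)
      have "fst q < n"
      proof (rule ccontr)
        assume "\<not> fst q < n"
        then have "Poly_Mapping.lookup t (fst q, snd q) = 0" unfolding lk by (auto intro!: sum.neutral dest: pt)
        with \<open>Poly_Mapping.lookup t (fst q, snd q) \<noteq> 0\<close> show False by simp
      qed
      then show "q \<in> {..<n} \<times> UNIV" by (cases q) auto
    qed
    show "(\<Sum>j\<in>UNIV. Poly_Mapping.lookup t (i, j)) = 1 + (\<Sum>l<k. if pt l = i then d - (\<Sum>j\<in>UNIV. \<beta> l j) else 0)" if "i < n" for i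
    proof -
      have "(\<Sum>j\<in>UNIV. \<tau> (\<pi> l) j - \<beta> l j) = d - (\<Sum>j\<in>UNIV. \<beta> l j)" if "l < k" for l
      proof -
        have "\<beta> l j \<le> \<tau> (\<pi> l) j" for j
        proof (rule ccontr)
          assume "\<not> \<beta> l j \<le> \<tau> (\<pi> l) j"
          then have "(\<Prod>j\<in>UNIV. of_nat (\<tau> (\<pi> l) j choose \<beta> l j) :: complex) = 0"
            by (intro prod_zero) (auto intro!: exI[of _ j] simp: binomial_eq_0)
          then have "c \<pi> = 0" using \<open>l < k\<close> unfolding c_def by (auto intro!: bexI[of _ l])
          with \<pi>(3) show False by simp
        qed
        moreover have "(\<Sum>j\<in>UNIV. \<tau> (\<pi> l) j) = d"
          using \<tau>[of "\<pi> l"] \<pi>(1) that permutes_in_image[of \<pi> "{0..<k}" l] by (simp add: P_def multi_indices_def)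
        ultimately show ?thesis using sum_subtractf_nat[of UNIV "\<beta> l" "\<tau> (\<pi> l)"] by simp
      qed
      then have "(\<Sum>l<k. \<Sum>j\<in>UNIV. if pt l = i then \<tau> (\<pi> l) j - \<beta> l j else 0)
          = (\<Sum>l<k. if pt l = i then d - (\<Sum>j\<in>UNIV. \<beta> l j) else 0)"
        by (intro sum.cong) auto
      then show ?thesis
        unfolding lk sum.distrib using that by (subst sum.swap) simp
    qed
  qed
  moreover have "{ps. length ps = n \<and> (\<forall>i<n. rep_proj_plane (ps ! i) $ chart i \<noteq> 0) \<and>
    det (mat k k (\<lambda>(l, c). hasse_monom (\<beta> l) (\<tau> c) (($) (rep_proj_plane (ps ! pt l))))) \<noteq> 0}
    = {ps. length ps = n \<and> \<not> (\<forall>f\<in>{f}. vanishes_at f ps)}"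
    by (auto simp: vanishes_at_def eval)
  ultimately show ?thesis unfolding zariski_open_def by blast
qed

lemma of_int_hasse_monom: "of_int (hasse_monom \<beta> \<tau> v) = hasse_monom \<beta> \<tau> (\<lambda>j. of_int (v j))"
  by (simp add: hasse_monom_def)

lemma hasse_monom_scale:
  fixes v :: "'x::finite \<Rightarrow> 'a::comm_ring_1"
  assumes "\<tau> \<in> multi_indices d"
  shows "hasse_monom \<beta> \<tau> (\<lambda>j. c * v j) = c ^ (d - (\<Sum>j\<in>UNIV. \<beta> j)) * hasse_monom \<beta> \<tau> v"
proof (cases "\<forall>j. \<beta> j \<le> \<tau> j")
  case True
  have "(\<Sum>j\<in>UNIV. \<tau> j - \<beta> j) = d - (\<Sum>j\<in>UNIV. \<beta> j)"
    using True assms sum_subtractf_nat[of UNIV \<beta> \<tau>] by (simp add: multi_indices_def)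
  then have "c ^ (d - (\<Sum>j\<in>UNIV. \<beta> j)) = (\<Prod>j\<in>UNIV. c ^ (\<tau> j - \<beta> j))" by (metis power_sum)
  then show ?thesis by (simp add: hasse_monom_def power_mult_distrib prod.distrib mult_ac)
next
  case False
  then obtain j where j: "\<tau> j < \<beta> j" by (auto simp: not_le)
  have "(\<Prod>j\<in>UNIV. of_nat (\<tau> j choose \<beta> j) * w j) = 0" for w :: "'x \<Rightarrow> 'a"
    using j by (intro prod_zero) (auto intro!: exI[of _ j] simp: binomial_eq_0)
  then show ?thesis by (simp add: hasse_monom_def)
qed

section \<open>The special points modulo 13\<close>

definition multi_index3 :: "nat \<Rightarrow> nat \<Rightarrow> nat \<Rightarrow> 3 \<Rightarrow> nat"
  where "multi_index3 a b c j = (if j = 1 then a else if j = 2 then b else c)"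

lemma prod_UNIV_3: "(\<Prod>j\<in>(UNIV :: 3 set). g j) = g 1 * g 2 * g 3"
  unfolding UNIV_3 by (simp add: mult.assoc)

lemma multi_index3_simps [simp]: "multi_index3 a b c 1 = a" "multi_index3 a b c 2 = b" "multi_index3 a b c 3 = c"
  by (simp_all add: multi_index3_def)

lemma multi_index3_eta: "multi_index3 (\<tau> 1) (\<tau> 2) (\<tau> 3) = \<tau>"
proof
  fix j show "multi_index3 (\<tau> 1) (\<tau> 2) (\<tau> 3) j = \<tau> j" using exhaust_3[of j] by auto
qed

lemma sum_multi_indices_3:
  "(\<Sum>\<tau>\<in>multi_indices d. g \<tau>) = (\<Sum>a\<le>d. \<Sum>b\<le>d. if a + b \<le> d then g (multi_index3 a b (d - a - b)) else 0)"
proof -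
  let ?S = "{(a, b). a \<le> d \<and> b \<le> d \<and> a + b \<le> d}"
  have "(\<Sum>\<tau>\<in>multi_indices d. g \<tau>) = (\<Sum>(a, b)\<in>?S. g (multi_index3 a b (d - a - b)))"
  proof (rule sum.reindex_bij_witness[where i = "\<lambda>(a, b). multi_index3 a b (d - a - b)" and j = "\<lambda>\<tau>. (\<tau> 1, \<tau> 2)"])
    fix \<tau> :: "3 \<Rightarrow> nat" assume "\<tau> \<in> multi_indices d"
    then have d: "\<tau> 1 + \<tau> 2 + \<tau> 3 = d" by (simp add: multi_indices_def sum_3)
    then have "multi_index3 (\<tau> 1) (\<tau> 2) (d - \<tau> 1 - \<tau> 2) = \<tau>" using multi_index3_eta[of \<tau>] by auto
    then show "(case (\<tau> 1, \<tau> 2) of (a, b) \<Rightarrow> multi_index3 a b (d - a - b)) = \<tau>" 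
      "(case (\<tau> 1, \<tau> 2) of (a, b) \<Rightarrow> g (multi_index3 a b (d - a - b))) = g \<tau>" by simp_all
    show "(\<tau> 1, \<tau> 2) \<in> ?S" using d by simp
  qed (auto simp: multi_indices_def sum_3)
  also have "\<dots> = (\<Sum>(a, b)\<in>{..d} \<times> {..d}. if a + b \<le> d then g (multi_index3 a b (d - a - b)) else 0)"
    by (intro sum.mono_neutral_cong_left) (auto split: if_splits)
  finally show ?thesis by (simp add: sum.cartesian_product)
qed

text \<open>
  The first two points are the coordinate points \<open>(1 : 0 : 0)\<close> and \<open>(0 : 1 : 0)\<close>, so that multiplicity
  \<open>m + \<alpha>\<close> there bounds the degrees in \<open>x\<close> and in \<open>y\<close>; the others lie in the affine plane \<open>z = 1\<close>.
\<close>

definition chart :: "nat \<Rightarrow> 3"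
  where "chart i = (if i = 0 then 1 else if i = 1 then 2 else 3)"

definition special_point :: "nat \<Rightarrow> 3 \<Rightarrow> int"
  where "special_point i j = (if j = chart i then 1 else if i < 2 then 0
    else if j = 1 then special_x (i - 2) else special_y (i - 2))"

text \<open>
  Pairs of a point and an order of derivation in the chart of this point.
\<close>

definition conditions :: "(nat \<Rightarrow> nat) \<Rightarrow> (nat \<times> (3 \<Rightarrow> nat)) set"
  where "conditions \<mu> = {(i, \<beta>). i < 10 \<and> \<beta> (chart i) = 0 \<and> (\<Sum>j\<in>UNIV. \<beta> j) < \<mu> i}"

text \<open>
  At a coordinate point the conditions are the vanishing of single coefficients.
\<close>

lemma sum_hasse_monom_coordinate_point:
  fixes c :: "(3 \<Rightarrow> nat) \<Rightarrow> 'a::comm_ring_1"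
  assumes \<sigma>: "\<sigma> \<in> multi_indices d"
  shows "(\<Sum>\<tau>\<in>multi_indices d. c \<tau> * hasse_monom (\<sigma>(i := 0)) \<tau> (\<lambda>j. if j = i then 1 else 0)) = c \<sigma>"
proof -
  have "hasse_monom (\<sigma>(i := 0)) \<tau> (\<lambda>j. if j = i then 1 else 0) = (if \<tau> = \<sigma> then 1 else 0 :: 'a)"
    if "\<tau> \<in> multi_indices d" for \<tau>
  proof (cases "\<forall>j. j \<noteq> i \<longrightarrow> \<tau> j = \<sigma> j")
    case True
    have "sum \<tau> UNIV = \<tau> i + sum \<tau> (UNIV - {i})" "sum \<sigma> UNIV = \<sigma> i + sum \<sigma> (UNIV - {i})"
      by (simp_all add: sum.remove)
    moreover have "sum \<tau> (UNIV - {i}) = sum \<sigma> (UNIV - {i})" using True by (intro sum.cong) auto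
    ultimately have "\<tau> i = \<sigma> i" using that \<sigma> by (simp add: multi_indices_def)
    then have "\<tau> = \<sigma>" using True by (metis ext)
    then show ?thesis by (auto simp: hasse_monom_def intro!: prod.neutral)
  next
    case False
    then obtain j where j: "j \<noteq> i" "\<tau> j \<noteq> \<sigma> j" by blast
    have "of_nat (\<tau> j choose (\<sigma>(i := 0)) j) * (if j = i then 1 else 0) ^ (\<tau> j - (\<sigma>(i := 0)) j) = (0 :: 'a)"
      using j by (cases "\<tau> j < \<sigma> j") (auto simp: binomial_eq_0 power_0_left)
    then have "hasse_monom (\<sigma>(i := 0)) \<tau> (\<lambda>j. if j = i then 1 else 0) = (0 :: 'a)"
      unfolding hasse_monom_def by (intro prod_zero finite_class.finite_UNIV bexI[of _ j] UNIV_I)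
    then show ?thesis using j by auto
  qed
  then have "(\<Sum>\<tau>\<in>multi_indices d. c \<tau> * hasse_monom (\<sigma>(i := 0)) \<tau> (\<lambda>j. if j = i then 1 else 0))
    = (\<Sum>\<tau>\<in>multi_indices d. if \<tau> = \<sigma> then c \<sigma> else 0)"
    by (intro sum.cong) auto
  also have "\<dots> = c \<sigma>" using \<sigma> by (subst sum.delta[OF finite_multi_indices]) simp
  finally show ?thesis .
qed

text \<open>
  The coefficients \<open>c\<close> are those of a polynomial with degrees at most \<open>2m + \<alpha>\<close> in \<open>x\<close> and \<open>y\<close> and total
  degree at most \<open>3m + 2\<alpha>\<close>.  If it were nonzero, then \<open>nef_class_nonneg\<close> would give
  \<open>34 m \<le> 10 (2m + \<alpha>) + 4 (3m + 2\<alpha>)\<close>, that is, \<open>m \<le> 9\<alpha>\<close>.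
\<close>

lemma no_curve_at_special_points:
  fixes c :: "(3 \<Rightarrow> nat) \<Rightarrow> 'a::field_gcd"
  assumes p: "int CHAR('a) = 13" and m: "9 * \<alpha> < m" and d: "d = 3 * m + 2 * \<alpha>"
    and \<mu>: "\<And>i. \<mu> i = (if i < 2 then m + \<alpha> else m)"
    and cond: "\<And>i \<beta>. (i, \<beta>) \<in> conditions \<mu> \<Longrightarrow>
      (\<Sum>\<tau>\<in>multi_indices d. c \<tau> * hasse_monom \<beta> \<tau> (\<lambda>j. of_int (special_point i j))) = 0"
    and \<tau>: "\<tau> \<in> multi_indices d"
  shows "c \<tau> = 0"
proof (rule ccontr)
  assume "c \<tau> \<noteq> 0"
  define f :: "'a poly poly" where "f = Poly (map (\<lambda>a. Poly (map (\<lambda>b. c (multi_index3 a b (d - a - b))) [0..<Suc d - a])) [0..<Suc d])"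
  have f: "coeff (coeff f a) b = (if a + b \<le> d then c (multi_index3 a b (d - a - b)) else 0)" for a b
    by (auto simp: f_def nth_default_def simp del: upt_Suc)
  have "\<tau> 1 + \<tau> 2 + \<tau> 3 = d" using \<tau> by (simp add: multi_indices_def sum_3)
  then have "coeff (coeff f (\<tau> 1)) (\<tau> 2) = c \<tau>" unfolding f using multi_index3_eta[of \<tau>] by auto
  with \<open>c \<tau> \<noteq> 0\<close> have f0: "f \<noteq> 0" by auto
  have coord: "c \<sigma> = 0" if "\<sigma> \<in> multi_indices d" "i < 2" "d < \<sigma> (chart i) + (m + \<alpha>)" for \<sigma> i
  proof -
    have "sum \<sigma> UNIV = \<sigma> (chart i) + sum \<sigma> (UNIV - {chart i})" by (simp add: sum.remove)
    moreover have "sum (\<sigma>(chart i := 0)) UNIV = sum \<sigma> (UNIV - {chart i})"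
      by (intro sum.mono_neutral_cong_right) auto
    ultimately have "(i, \<sigma>(chart i := 0)) \<in> conditions \<mu>"
      using that by (simp add: conditions_def \<mu> multi_indices_def)
    from cond[OF this] show ?thesis
      using sum_hasse_monom_coordinate_point[OF that(1), of c "chart i"] \<open>i < 2\<close>
      by (simp add: special_point_def if_distrib[of of_int] cong: if_cong)
  qed
  have degX: "degX f \<le> 2 * m + \<alpha>"
    unfolding degX_le_iff
  proof (intro allI impI)
    fix a b assume "2 * m + \<alpha> < a"
    then show "coeff (coeff f a) b = 0"
      unfolding f by (auto intro!: coord[of _ 0] simp: chart_def d multi_indices_def sum_3)
  qed
  have degY: "degY f \<le> 2 * m + \<alpha>"
    unfolding degY_le_iff
  proof (intro allI impI)
    fix a b assume "2 * m + \<alpha> < b"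
    then show "coeff (coeff f a) b = 0"
      unfolding f by (auto intro!: coord[of _ 1] simp: chart_def d multi_indices_def sum_3)
  qed
  have degT: "degT f \<le> d" unfolding degT_le_iff f by auto
  have mult: "m \<le> mult2 (of_int (special_x i)) (of_int (special_y i)) f" if "i < 8" for i
    unfolding mult2_ge_iff[OF f0]
  proof (intro allI impI)
    fix r s assume "r + s < m"
    then have rs: "(i + 2, multi_index3 r s 0) \<in> conditions \<mu>"
      using that by (simp add: conditions_def \<mu> chart_def sum_3)
    have b: "degX f \<le> d" "degY f \<le> d"
      unfolding degY_le_iff unfolding degX_le_iff f by auto
    have "coeff (coeff (shift2 (of_int (special_x i)) (of_int (special_y i)) f) r) s
      = (\<Sum>\<tau>\<in>multi_indices d. c \<tau> * hasse_monom (multi_index3 r s 0) \<tau> (\<lambda>j. of_int (special_point (i + 2) j)))"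
      unfolding coeff_shift2[OF b] sum_multi_indices_3 f
      by (intro sum.cong refl) (simp add: hasse_monom_def prod_UNIV_3 special_point_def chart_def mult_ac)
    then show "coeff (coeff (shift2 (of_int (special_x i)) (of_int (special_y i)) f) r) s = 0"
      using cond[OF rs] by simp
  qed
  have "(\<Sum>i<8::nat. int m) \<le> (\<Sum>i<8. int (mult2 (of_int (special_x i)) (of_int (special_y i)) f))"
    using mult by (intro sum_mono) auto
  then show False
    using nef_class_nonneg[OF p f0] mult[of 5] mult[of 6] degX degY degT m d by simp
qed

text \<open>
  An index type for the field with 13 elements, which is \<open>thirteen mod_ring\<close>.
\<close>

typedef thirteen = "{0..<13 :: nat}" by (intro exI[of _ 0]) simp

lemma CARD_thirteen: "CARD(thirteen) = 13"
  using type_definition.card[OF type_definition_thirteen] by simp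

instance thirteen :: finite
proof
  show "finite (UNIV :: thirteen set)"
    using type_definition.univ[OF type_definition_thirteen] by (metis finite_atLeastLessThan finite_imageI)
qed

instance thirteen :: prime_card
proof
  show "prime CARD(thirteen)" unfolding CARD_thirteen by simp
qed

lemma CHAR_thirteen: "int CHAR(thirteen mod_ring) = 13"
  by (simp add: CARD_thirteen)

section \<open>The linear system at general points\<close>

theorem theorem4p2:
  fixes \<alpha> m :: nat
  assumes "\<alpha> > 0" and "m > 9 * \<alpha>"
  shows "for_general_points 10 (\<lambda>ps.
    linear_system (3 * m + 2 * \<alpha>) (replicate 2 (m + \<alpha>) @ replicate 8 m) ps = {})"
proof -
  define d where "d = 3 * m + 2 * \<alpha>"
  define \<mu> :: "nat \<Rightarrow> nat" where "\<mu> i = (if i < 2 then m + \<alpha> else m)" for i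
  let ?T = "multi_indices d :: (3 \<Rightarrow> nat) set"
  define k where "k = card ?T"
  obtain \<tau> where \<tau>: "bij_betw \<tau> {..<k} ?T"
    using ex_bij_betw_nat_finite[OF finite_multi_indices[of d]] by (auto simp: k_def atLeast0LessThan)
  have \<tau>T: "\<tau> l \<in> ?T" if "l < k" for l using bij_betwE[OF \<tau>] that by blast
  \<comment> \<open>Modulo 13 the conditions have no common solution, so \<open>k\<close> of them give a nonzero minor.\<close>
  have "\<exists>\<rho>. (\<forall>l<k. \<rho> l \<in> conditions \<mu>) \<and>
    det (mat k k (\<lambda>(l, c). (\<lambda>(i, \<beta>) c. hasse_monom \<beta> (\<tau> c) (special_point i)) (\<rho> l) c)) \<noteq> 0"
  proof (rule nonzero_integral_minor_exists)
    fix x :: "nat \<Rightarrow> thirteen mod_ring" and l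
    assume x: "\<And>r. r \<in> conditions \<mu> \<Longrightarrow> (\<Sum>c<k. of_int ((\<lambda>(i, \<beta>) c. hasse_monom \<beta> (\<tau> c) (special_point i)) r c) * x c) = 0" and "l < k"
    define y where "y \<sigma> = x (inv_into {..<k} \<tau> \<sigma>)" for \<sigma>
    have y: "y (\<tau> c) = x c" if "c < k" for c
      using bij_betw_inv_into_left[OF \<tau>, of c] that by (simp add: y_def)
    have "y (\<tau> l) = 0"
    proof (rule no_curve_at_special_points[OF CHAR_thirteen assms(2) d_def \<mu>_def _ \<tau>T[OF \<open>l < k\<close>]])
      fix i \<beta> assume "(i, \<beta>) \<in> conditions \<mu>"
      from x[OF this] show "(\<Sum>\<sigma>\<in>?T. y \<sigma> * hasse_monom \<beta> \<sigma> (\<lambda>j. of_int (special_point i j))) = 0"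
        by (subst sum.reindex_bij_betw[OF \<tau>, symmetric]) (simp add: y of_int_hasse_monom mult.commute)
    qed
    then show "x l = 0" using y \<open>l < k\<close> by simp
  qed
  then obtain \<rho> where \<rho>: "\<And>l. l < k \<Longrightarrow> \<rho> l \<in> conditions \<mu>"
    and minor: "det (mat k k (\<lambda>(l, c). hasse_monom (snd (\<rho> l)) (\<tau> c) (special_point (fst (\<rho> l))))) \<noteq> 0"
    by (auto simp: case_prod_unfold)
  define M where "M ps l c = hasse_monom (snd (\<rho> l)) (\<tau> c) (($) (rep_proj_plane (ps ! fst (\<rho> l))))" for ps l c
  define U where "U = {ps. length ps = 10 \<and> (\<forall>i<10. rep_proj_plane (ps ! i) $ chart i \<noteq> 0) \<and> det (mat k k (\<lambda>(l, c). M ps l c)) \<noteq> 0}"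
  have "zariski_open 10 U"
    unfolding U_def M_def by (rule zariski_open_minor[where \<beta> = "\<lambda>l. snd (\<rho> l)"]) (use \<rho> \<tau>T in \<open>fastforce simp: conditions_def\<close>)+
  moreover have "U \<noteq> {}"
  proof -
    define w where "w i = (\<chi> j. complex_of_int (special_point i j))" for i
    have w: "w i $ chart i = 1" for i by (simp add: w_def special_point_def)
    define ps where "ps = map (\<lambda>i. abs_proj_plane (w i)) [0..<10]"
    have "\<exists>c. c \<noteq> 0 \<and> rep_proj_plane (ps ! i) = c *s w i" if "i < 10" for i
    proof -
      have "w i \<noteq> 0" using w[of i] by (metis zero_index zero_neq_one)
      then have "proportional (w i) (w i)" unfolding proportional_def by (auto intro!: exI[of _ 1])
      then have "proportional (w i) (rep_proj_plane (abs_proj_plane (w i)))"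
        using sympD[OF Quotient3_symp[OF Quotient3_proj_plane]] Quotient3_rep_abs[OF Quotient3_proj_plane] by blast
      then show ?thesis using that by (auto simp: ps_def proportional_def)
    qed
    then obtain c where c: "\<And>i. i < 10 \<Longrightarrow> c i \<noteq> 0 \<and> rep_proj_plane (ps ! i) = c i *s w i" by metis
    have pt: "fst (\<rho> l) < 10" if "l < k" for l using \<rho>[OF that] by (auto simp: conditions_def)
    \<comment> \<open>The representative chosen by the quotient type differs from \<open>w\<close> by a scalar, which only rescales rows.\<close>
    have entry: "M ps l j = c (fst (\<rho> l)) ^ (d - (\<Sum>j\<in>UNIV. snd (\<rho> l) j)) * of_int (hasse_monom (snd (\<rho> l)) (\<tau> j) (special_point (fst (\<rho> l))))"
      if "l < k" "j < k" for l j
    proof -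
      have "($) (rep_proj_plane (ps ! fst (\<rho> l))) = (\<lambda>j. c (fst (\<rho> l)) * of_int (special_point (fst (\<rho> l)) j))"
        using c[OF pt[OF that(1)]] by (simp add: w_def fun_eq_iff)
      then show ?thesis
        unfolding M_def by (simp add: hasse_monom_scale[OF \<tau>T[OF that(2)]] of_int_hasse_monom)
    qed
    have "det (mat k k (\<lambda>(l, c). M ps l c)) \<noteq> 0"
    proof
      assume "det (mat k k (\<lambda>(l, c). M ps l c)) = 0"
      then obtain x where x: "\<exists>j<k. x j \<noteq> 0" "\<And>l. l < k \<Longrightarrow> (\<Sum>j<k. M ps l j * x j) = 0"
        unfolding det_of_rows_zero_if_kernel by blast
      have "(\<Sum>j<k. of_int (hasse_monom (snd (\<rho> l)) (\<tau> j) (special_point (fst (\<rho> l)))) * x j) = 0" if "l < k" for l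
        using x(2)[OF that] c[OF pt[OF that]] by (simp add: entry that mult.assoc flip: sum_distrib_left)
      then have "det (mat k k (\<lambda>(l, j). of_int (hasse_monom (snd (\<rho> l)) (\<tau> j) (special_point (fst (\<rho> l)))) :: complex)) = 0"
        unfolding det_of_rows_zero_if_kernel using x(1) by blast
      moreover have "mat k k (\<lambda>(l, j). of_int (hasse_monom (snd (\<rho> l)) (\<tau> j) (special_point (fst (\<rho> l)))) :: complex)
        = map_mat of_int (mat k k (\<lambda>(l, j). hasse_monom (snd (\<rho> l)) (\<tau> j) (special_point (fst (\<rho> l)))))"
        by (rule eq_matI) auto
      ultimately show False using minor by simp
    qed
    moreover have "rep_proj_plane (ps ! i) $ chart i \<noteq> 0" if "i < 10" for i
      using c[OF that] w[of i] by simp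
    ultimately have "ps \<in> U" by (simp add: U_def ps_def)
    then show ?thesis by blast
  qed
  moreover have "linear_system d (replicate 2 (m + \<alpha>) @ replicate 8 m) ps = {}" if ps: "ps \<in> U" for ps
  proof (rule ccontr)
    assume "linear_system d (replicate 2 (m + \<alpha>) @ replicate 8 m) ps \<noteq> {}"
    then obtain F where F: "F \<noteq> 0" "homogeneous d F"
      and "\<forall>i<10. enat ((replicate 2 (m + \<alpha>) @ replicate 8 m) ! i) \<le> multiplicity F (ps ! i)"
      by (auto simp: linear_system_def)
    then have mult: "enat (\<mu> i) \<le> multiplicity F (ps ! i)" if "i < 10" for i
      using that by (auto simp: \<mu>_def nth_append)
    define x where "x c = Poly_Mapping.lookup F (Abs_poly_mapping (\<tau> c))" for c
    have "(\<Sum>c<k. M ps l c * x c) = 0" if l: "l < k" for l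
    proof -
      obtain i \<beta> where i: "\<rho> l = (i, \<beta>)" "i < 10" "\<beta> (chart i) = 0" "(\<Sum>j\<in>UNIV. \<beta> j) < \<mu> i"
        using \<rho>[OF l] by (auto simp: conditions_def)
      then have "rep_proj_plane (ps ! i) $ chart i \<noteq> 0" using ps by (simp add: U_def)
      from hasse_conditions_if_multiplicity[OF F(2) mult[OF i(2)] this i(3,4)]
      show ?thesis unfolding M_def x_def i(1)
        by (subst (asm) sum.reindex_bij_betw[OF \<tau>, symmetric]) (simp add: mult.commute)
    qed
    moreover have "\<exists>c<k. x c \<noteq> 0"
    proof (rule ccontr)
      assume "\<not> ?thesis"
      then have "\<And>c. c < k \<Longrightarrow> x c = 0" by auto
      then have z: "Poly_Mapping.lookup F (Abs_poly_mapping \<sigma>) = 0" if "\<sigma> \<in> ?T" for \<sigma>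
      proof -
        obtain c where "c < k" "\<sigma> = \<tau> c" using bij_betw_imp_surj_on[OF \<tau>] \<open>\<sigma> \<in> ?T\<close> by auto
        then show ?thesis using \<open>\<And>c. c < k \<Longrightarrow> x c = 0\<close>[of c] by (simp add: x_def)
      qed
      obtain t where t: "t \<in> Poly_Mapping.keys F" using F(1) by fastforce
      have "(\<Sum>j\<in>UNIV. Poly_Mapping.lookup t j) = monom_deg t"
        unfolding monom_deg_def by (intro sum.mono_neutral_right) (auto simp: in_keys_iff)
      then have "Poly_Mapping.lookup t \<in> ?T" using F(2) t by (simp add: homogeneous_def multi_indices_def)
      from z[OF this] t show False by (simp add: Abs_lookup in_keys_iff)
    qed
    ultimately have "det (mat k k (\<lambda>(l, c). M ps l c)) = 0" unfolding det_of_rows_zero_if_kernel by blast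
    with ps show False by (simp add: U_def)
  qed
  ultimately show ?thesis unfolding for_general_points_def d_def by blast
qed

end
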